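(* Let $a,b>1$ and $\gamma>0$, and suppose that $\frac1b+\frac1a<1$. Consider the ODE in $\mathbb{R}^2$ $$x_t'=|p_t|^{a-1}\operatorname{sgn}(p_t),\qquad p_t'=-|x_t|^{b-1}\operatorname{sgn}(x_t)-\gamma p_t .$$ For any $\theta\in\mathbb{R}$ denote by $(x^{(\theta)}_t,p^{(\theta)}_t)$ its unique solution with $x_0=\theta$, $p_0=0$. Then there exists a constant $\eta\in(0,\infty)$ depending on $a$ and $b$ such that the path $(x^{(\eta)}_t,p^{(\eta)}_t)$ and its mirrored version $(x^{(-\eta)}_t,p^{(-\eta)}_t)$ satisfy $$|x^{(-\eta)}_t|=|x^{(\eta)}_t|\le O(\exp(-\alpha t))\ \text{ for every }\alpha<\gamma(a-1)\ \text{ as }t\to\infty.$$ For any path $(x_t,p_t)$ that is not a time translation of $(x^{(\eta)}_t,p^{(\eta)}_t)$ or $(x^{(-\eta)}_t,p^{(-\eta)}_t)$, one has $$|x_t^{-1}|=O\big(t^{\frac{1}{ba-b-a}}\big)\ \text{ as }t\to\infty,$$ so the speed of convergence is sub-linear and not linearly fast (here "linear" convergence means exponentially fast in $t$).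
   Context: This ODE is $x_t'=k'(p_t)$, $p_t'=-f'(x_t)-\gamma p_t$ for $f(x)=|x|^b/b$, $k(p)=|p|^a/a$ on $\mathbb{R}$; every initial condition has a unique solution defined for all $t\in\mathbb{R}$. A path is a solution $(x_t,p_t)_{t\in\mathbb{R}}$ of this ODE. A time translation of a path $(y_t,q_t)$ is a path $(y_{t+\Delta},q_{t+\Delta})$ with $\Delta\in\mathbb{R}$. Here $\operatorname{sgn}(0)=0$.
   Formalization: The path that is identically zero is excluded from "any path" (there x_t^{-1} is undefined and the claim fails), and the constant η depends on γ as well as on a and b, since by rescaling no single η can serve all γ. *)

theory Defs
  imports "HOL-Analysis.Analysis" "HOL-Library.Landau_Symbols"
begin

text \<open>With \<open>f(x) = |x|^b / b\<close> and \<open>k(p) = |p|^a / a\<close> this is the vector field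
  \<open>(k'(p), - f'(x) - \<gamma> p)\<close> at the state \<open>(x, p)\<close>.\<close>

definition damped_field :: "real \<Rightarrow> real \<Rightarrow> real \<Rightarrow> real \<times> real \<Rightarrow> real \<times> real" where
  "damped_field a b \<gamma> = (\<lambda>(x, p).
     (\<bar>p\<bar> powr (a - 1) * sgn p, - (\<bar>x\<bar> powr (b - 1) * sgn x) - \<gamma> * p))"

definition is_path :: "real \<Rightarrow> real \<Rightarrow> real \<Rightarrow> (real \<Rightarrow> real \<times> real) \<Rightarrow> bool" where
  "is_path a b \<gamma> z \<longleftrightarrow>
     (\<forall>t. (z has_vector_derivative damped_field a b \<gamma> (z t)) (at t))"

definition is_time_translation ::
  "(real \<Rightarrow> real \<times> real) \<Rightarrow> (real \<Rightarrow> real \<times> real) \<Rightarrow> bool" where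
  "is_time_translation z w \<longleftrightarrow> (\<exists>\<Delta>. z = (\<lambda>t. w (t + \<Delta>)))"

text \<open>The solution started from rest at position \<open>\<theta>\<close>.  The definite description is meaningful
  because every initial condition has exactly one solution on all of \<open>\<real>\<close>.\<close>

definition rest_path :: "real \<Rightarrow> real \<Rightarrow> real \<Rightarrow> real \<Rightarrow> real \<Rightarrow> real \<times> real" where
  "rest_path a b \<gamma> \<theta> = (THE z. is_path a b \<gamma> z \<and> z 0 = (\<theta>, 0))"

text \<open>Linear convergence to \<open>0\<close> means exponentially fast in \<open>t\<close>; sub-linear means slower
  than every exponential rate.\<close>

definition linearly_fast :: "(real \<Rightarrow> real) \<Rightarrow> bool" where
  "linearly_fast x \<longleftrightarrow> (\<exists>c>0. x \<in> O(\<lambda>t. exp (- c * t)))"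

definition sublinearly_fast :: "(real \<Rightarrow> real) \<Rightarrow> bool" where
  "sublinearly_fast x \<longleftrightarrow> (\<forall>c>0. (\<lambda>t. exp (- c * t)) \<in> o(x))"

end

theory Submission
  imports Defs "HOL-Complex_Analysis.Great_Picard" "HOL-Real_Asymp.Real_Asymp"
begin

text \<open>The energy \<open>\<bar>x\<bar>\<^sup>b / b + \<bar>p\<bar>\<^sup>a / a\<close> decreases to \<open>0\<close> along every path but never reaches it.  Since
  \<open>(a - 1) (b - 1) > 1\<close>, the region \<open>0 \<le> - p \<le> (2 / \<gamma>) x\<^sup>b\<^sup>-\<^sup>1\<close> is forward invariant for small \<open>x > 0\<close>.
  In it \<open>x' \<ge> - C x\<^sup>m\<close> with \<open>m = (a - 1) (b - 1)\<close>, which gives the lower bound on \<open>x\<close>.  A path that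
  never enters this region or its mirror image cannot meet the axis \<open>p = 0\<close> near the origin, so it
  finally stays, up to symmetry, in the quadrant \<open>x > 0 > p\<close>.  There \<open>\<bar>p\<bar>\<^sup>a\<^sup>-\<^sup>1\<close> is a function \<open>v\<close> of \<open>x\<close> with
  \<open>v(0) = 0\<close> and \<open>v'(x) = (a - 1) (\<gamma> - x\<^sup>b\<^sup>-\<^sup>1 / \<bar>p\<bar>)\<close>.  This equation has exactly one relevant solution,
  because its Lipschitz constant is integrable at \<open>0\<close>, and \<open>v(x)\<close> is close to \<open>(a - 1) \<gamma> x\<close> for small \<open>x\<close>,
  so that \<open>x' = - v(x)\<close> gives the exponential rate.  Followed backwards in time, the corresponding path
  comes to rest at some point, which determines \<open>\<eta>\<close>.\<close>

text \<open>For \<open>a < 2\<close> or \<open>b < 2\<close> the field is not Lipschitz on the axes,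
  so the Picard-Lindeloef theorem does not apply. Existence therefore rests on compactness, and
  uniqueness is proved separately away from the origin by exchanging one coordinate for the energy.
  The origin is reached in no finite time, forwards or backwards, since the energy changes at most
  exponentially. The two rates reflect two balances in p' = -x^(b-1) - \<gamma> p for x > 0 > p. If
  force and friction nearly cancel, then -p is of order x^(b-1) and x' of order -x^m, which is
  slower than exponential decay because m > 1; x^(1-m) then grows linearly, and m - 1 = ba - b - a
  is the reciprocal of the exponent in the statement. If the force is negligible, p decays like
  exp(-\<gamma> t) and x like |p|^(a-1), whence the rate \<gamma> (a - 1). The second balance is
  consistent because, again by m > 1, x^(b-1) is small against |p|, which is of order
  x^(1/(a-1)).\<close>

definition spow :: "real \<Rightarrow> real \<Rightarrow> real" where
  "spow c u = \<bar>u\<bar> powr (c - 1) * sgn u"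

lemma spow_zero [simp]: "spow c 0 = 0"
  by (simp add: spow_def)

lemma spow_minus [simp]: "spow c (- u) = - spow c u"
  by (simp add: spow_def)

lemma spow_pos: "u > 0 \<Longrightarrow> spow c u = u powr (c - 1)"
  by (simp add: spow_def)

lemma spow_neg: "u < 0 \<Longrightarrow> spow c u = - ((- u) powr (c - 1))"
  by (simp add: spow_def)

lemma spow_mult_self:
  assumes "c > 1"
  shows "u * spow c u = \<bar>u\<bar> powr c"
proof (cases "u = 0")
  case False
  then have "u * spow c u = \<bar>u\<bar> * \<bar>u\<bar> powr (c - 1)"
    by (simp add: spow_def abs_sgn mult_ac)
  then show ?thesis
    using False by (simp add: powr_mult_base)
qed simp

lemma abs_spow: "\<bar>spow c u\<bar> = \<bar>u\<bar> powr (c - 1)"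
  by (cases "u = 0") (auto simp: spow_def abs_mult)

lemma continuous_on_spow [continuous_intros]:
  assumes "c > 1" and "continuous_on S f"
  shows "continuous_on S (\<lambda>x. spow c (f x))"
proof -
  \<comment> \<open>Positive and negative part have nonnegative values, where a power with positive
    exponent is continuous also at 0.\<close>
  have eq: "spow c u = max u 0 powr (c - 1) - max (- u) 0 powr (c - 1)" for u
    by (cases u "0::real" rule: linorder_cases) (auto simp: spow_def)
  show ?thesis
    unfolding eq using assms(1)
    by (intro continuous_on_diff continuous_on_powr' continuous_on_max continuous_on_minus
        continuous_on_const assms(2)) auto
qed

lemma abs_powr_has_derivative:
  fixes u c :: real
  assumes "c > 1"
  shows "((\<lambda>u. \<bar>u\<bar> powr c / c) has_real_derivative spow c u) (at u within S)"
proof (cases u "0::real" rule: linorder_cases)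
  case less
  have "((\<lambda>u. (- u) powr c / c) has_real_derivative spow c u) (at u)"
    using less assms by (auto intro!: derivative_eq_intros simp: spow_neg field_simps)
  moreover have "\<forall>\<^sub>F v in nhds u. (- v) powr c / c = \<bar>v\<bar> powr c / c"
    using eventually_mono[OF eventually_nhds_in_open[of "{..<0}" u]] less
    by fastforce
  ultimately have "((\<lambda>u. \<bar>u\<bar> powr c / c) has_real_derivative spow c u) (at u)"
    by (rule DERIV_cong_ev[OF refl _ refl, THEN iffD1, rotated])
  then show ?thesis
    by (rule has_field_derivative_at_within)
next
  case greater
  have "((\<lambda>u. u powr c / c) has_real_derivative spow c u) (at u)"
    using greater assms by (auto intro!: derivative_eq_intros simp: spow_pos field_simps)
  moreover have "\<forall>\<^sub>F v in nhds u. v powr c / c = \<bar>v\<bar> powr c / c"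
    using eventually_mono[OF eventually_nhds_in_open[of "{0<..}" u]] greater
    by fastforce
  ultimately have "((\<lambda>u. \<bar>u\<bar> powr c / c) has_real_derivative spow c u) (at u)"
    by (rule DERIV_cong_ev[OF refl _ refl, THEN iffD1, rotated])
  then show ?thesis
    by (rule has_field_derivative_at_within)
next
  case equal
  have "continuous_on UNIV (\<lambda>h. spow c h / c)"
    using assms by (intro continuous_intros) auto
  then have "((\<lambda>h. spow c h / c) \<longlongrightarrow> spow c 0 / c) (at 0)"
    unfolding continuous_on_def by blast
  \<comment> \<open>Since \<open>h * spow c h\<close> is the \<open>c\<close>-th power of the
    absolute value, the difference quotient at 0 is \<open>spow c h / c\<close> itself; its limit is
    its value at 0.\<close>
  moreover have "\<forall>\<^sub>F h in at 0. spow c h / c = (\<bar>0 + h\<bar> powr c / c - \<bar>0\<bar> powr c / c) / h"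
    by (auto simp: eventually_at_filter spow_mult_self[OF assms, symmetric])
  ultimately have "((\<lambda>h. (\<bar>0 + h\<bar> powr c / c - \<bar>0\<bar> powr c / c) / h) \<longlongrightarrow> 0) (at 0)"
    by (simp add: tendsto_cong)
  then have "((\<lambda>u. \<bar>u\<bar> powr c / c) has_real_derivative spow c 0) (at 0)"
    unfolding DERIV_def by simp
  then show ?thesis
    using equal has_field_derivative_at_within by blast
qed

section \<open>Monotonicity, a Gronwall inequality and induction along the real line\<close>

lemma nondecreasing_within:
  fixes f f' :: "real \<Rightarrow> real"
  assumes "s \<le> u" and "{s..u} \<subseteq> S"
    and "\<And>t. t \<in> {s..u} \<Longrightarrow> (f has_real_derivative f' t) (at t within S)"
    and "\<And>t. t \<in> {s..u} \<Longrightarrow> 0 \<le> f' t"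
  shows "f s \<le> f u"
proof -
  have "(f has_derivative (*) (f' t)) (at t within {s..u})" if "s \<le> t" "t \<le> u" for t
    using assms(3)[of t] that has_field_derivative_subset[OF _ assms(2)]
    by (auto simp: has_field_derivative_def)
  then obtain t where "t \<in> {s..u}" "f u - f s = f' t * (u - s)"
    using mvt_very_simple[OF \<open>s \<le> u\<close>, of f "\<lambda>t. (*) (f' t)"] by auto
  then show ?thesis
    using assms(1) assms(4)[of t] mult_nonneg_nonneg[of "f' t" "u - s"] by linarith
qed

lemma nonincreasing_within:
  fixes f f' :: "real \<Rightarrow> real"
  assumes "s \<le> u" and "{s..u} \<subseteq> S"
    and "\<And>t. t \<in> {s..u} \<Longrightarrow> (f has_real_derivative f' t) (at t within S)"
    and "\<And>t. t \<in> {s..u} \<Longrightarrow> f' t \<le> 0"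
  shows "f u \<le> f s"
  using nondecreasing_within[of s u S "\<lambda>t. - f t" "\<lambda>t. - f' t"] assms
  by (auto intro: DERIV_minus)

text \<open>The integrating factor \<open>exp (- K * t)\<close> makes \<open>D\<close>
  nonincreasing, and only the sign of \<open>D\<close> matters.\<close>

lemma gronwall_zero:
  fixes D D' :: "real \<Rightarrow> real"
  assumes "s \<le> u" and "{s..u} \<subseteq> S"
    and D: "\<And>t. t \<in> {s..u} \<Longrightarrow> (D has_real_derivative D' t) (at t within S)"
    and le: "\<And>t. t \<in> {s..u} \<Longrightarrow> D' t \<le> K * D t"
    and "D s \<le> 0"
  shows "D u \<le> 0"
proof -
  have "D u * exp (- K * u) \<le> D s * exp (- K * s)"
  proof (rule nonincreasing_within[OF assms(1,2)])
    fix t assume t: "t \<in> {s..u}"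
    show "((\<lambda>t. D t * exp (- K * t)) has_real_derivative (D' t - K * D t) * exp (- K * t))
        (at t within S)"
      by (rule derivative_eq_intros D[OF t] refl)+ (simp add: algebra_simps)
    show "(D' t - K * D t) * exp (- K * t) \<le> 0"
      using le[OF t] by (simp add: mult_le_0_iff)
  qed
  also have "\<dots> \<le> 0"
    using assms(5) by (simp add: mult_le_0_iff)
  finally show ?thesis by (simp add: mult_le_0_iff)
qed

text \<open>At the infimum of the failures, \<open>P\<close> still holds by \<open>lim\<close>, and
  \<open>step\<close> extends it beyond, against the choice of the infimum. The bound
  \<open>r \<le> T\<close> in \<open>step\<close> admits functions that solve an equation only up to
  \<open>T\<close>.\<close>

lemma continuous_induction:
  fixes s :: real
  assumes "P s"
    and lim: "\<And>t. s < t \<Longrightarrow> t \<le> T \<Longrightarrow> (\<And>r. s \<le> r \<Longrightarrow> r < t \<Longrightarrow> P r) \<Longrightarrow> P t"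
    and step: "\<And>t. s \<le> t \<Longrightarrow> t < T \<Longrightarrow> (\<And>r. s \<le> r \<Longrightarrow> r \<le> t \<Longrightarrow> P r) \<Longrightarrow>
        \<exists>e>0. \<forall>r. t \<le> r \<and> r < t + e \<and> r \<le> T \<longrightarrow> P r"
    and "s \<le> t" "t \<le> T"
  shows "P t"
proof (rule ccontr)
  assume "\<not> P t"
  define B where "B = {r. s \<le> r \<and> r \<le> T \<and> \<not> P r}"
  have "t \<in> B" using \<open>\<not> P t\<close> assms(4,5) by (simp add: B_def)
  have bdd: "bdd_below B" by (auto simp: B_def intro: bdd_belowI[of _ s])
  define i where "i = Inf B"
  have lower: "i \<le> r" if "r \<in> B" for r
    unfolding i_def using bdd that by (rule cInf_lower[rotated])
  have "s \<le> i"
    unfolding i_def using \<open>t \<in> B\<close> by (intro cInf_greatest) (auto simp: B_def)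
  have "i \<le> t" using lower[OF \<open>t \<in> B\<close>] .
  have before: "P r" if "s \<le> r" "r < i" for r
    using lower[of r] that \<open>i \<le> t\<close> \<open>t \<le> T\<close> by (force simp: B_def)
  have "P i"
  proof (cases "i = s")
    case False
    then show ?thesis using lim[of i] \<open>s \<le> i\<close> \<open>i \<le> t\<close> \<open>t \<le> T\<close> before by auto
  qed (use assms(1) in simp)
  have "i < t" using \<open>P i\<close> \<open>\<not> P t\<close> \<open>i \<le> t\<close> by (cases "i = t") auto
  then obtain e where e: "e > 0" "\<And>r. i \<le> r \<Longrightarrow> r < i + e \<Longrightarrow> r \<le> T \<Longrightarrow> P r"
    using step[of i] \<open>s \<le> i\<close> \<open>t \<le> T\<close> before \<open>P i\<close> by (metis antisym_conv1 order.strict_trans1 not_le)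
  obtain r where "r \<in> B" "r < i + e"
    using cInf_lessD[of B "i + e"] \<open>t \<in> B\<close> e(1) unfolding i_def by auto
  then show False
    using e(2)[of r] lower[of r] by (auto simp: B_def)
qed

subsection \<open>Peano's existence theorem\<close>

text \<open>The solution is a limit of functions with \<open>y'(t) = F (y (t - h))\<close> as \<open>h\<close> tends to \<open>0\<close>.  Iterating the
  integral equation with delay \<open>h\<close> becomes stationary on \<open>[0, k h]\<close> after \<open>k\<close> steps, so no contraction
  is needed.\<close>

theorem peano:
  fixes F :: "'a::euclidean_space \<Rightarrow> 'a"
  assumes F: "continuous_on UNIV F" and bound: "\<And>z. norm (F z) \<le> B" and T: "0 \<le> T"
  obtains z where "z 0 = z0"
    and "\<And>t. t \<in> {0..T} \<Longrightarrow> (z has_vector_derivative F (z t)) (at t within {0..T})"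
proof -
  define h where "h n = 1 / (real n + 1)" for n
  have h: "h n > 0" for n by (simp add: h_def)
  \<comment> \<open>Cutting the delayed argument off at 0 continues \<open>y\<close> to the left by
    its initial value.\<close>
  define step where
    "step n y t = z0 + integral {0..t} (\<lambda>s. F (y (max 0 (s - h n))))" for n y and t :: real
  have B: "B \<ge> 0" using order_trans[OF norm_ge_zero bound] .
  have intF: "(\<lambda>s. F (y (max 0 (s - h n)))) integrable_on {r..t}"
    if "continuous_on {0..} y" for y :: "real \<Rightarrow> 'a" and n r t
    by (intro integrable_continuous_interval continuous_on_compose2[OF F]
        continuous_on_compose2[OF that]) (auto intro!: continuous_intros)
  have lip: "norm (step n y t - step n y s) \<le> B * \<bar>t - s\<bar>"
    if y: "continuous_on {0..} y" and "0 \<le> s" "0 \<le> t" for n y s t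
  proof -
    have *: "norm (step n y t - step n y s) \<le> B * \<bar>t - s\<bar>" if "0 \<le> s" "s \<le> t" for s t
    proof -
      have "step n y t - step n y s = integral {s..t} (\<lambda>s. F (y (max 0 (s - h n))))"
        unfolding step_def
        using Henstock_Kurzweil_Integration.integral_combine[OF that intF[OF y, of n]]
        by (simp add: algebra_simps)
      also have "norm \<dots> \<le> B * (t - s)"
        using integral_bound[OF \<open>s \<le> t\<close>, of "\<lambda>s. F (y (max 0 (s - h n)))" B] bound
          B intF[OF y, of n] that
        by (metis (no_types, lifting) content_real has_integral_bound_real integrable_integral finite.emptyI)
      finally show ?thesis using that by simp
    qed
    show ?thesis
      using *[of s t] *[of t s] that by (cases "s \<le> t") (auto simp: norm_minus_commute abs_minus_commute)
  qed
  have cont_step: "continuous_on {0..} (step n y)" if "continuous_on {0..} y" for n y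
    unfolding continuous_on_iff
  proof (intro ballI allI impI)
    fix s e :: real assume s: "s \<in> {0..}" and e: "e > 0"
    show "\<exists>d>0. \<forall>t\<in>{0..}. dist t s < d \<longrightarrow> dist (step n y t) (step n y s) < e"
    proof (intro exI[of _ "e / (B + 1)"] conjI ballI impI)
      fix t assume t: "t \<in> {0..}" "dist t s < e / (B + 1)"
      have "dist (step n y t) (step n y s) \<le> B * \<bar>t - s\<bar>"
        using lip[OF that, of s t n] s t by (simp add: dist_norm)
      also have "\<dots> \<le> (B + 1) * \<bar>t - s\<bar>" by (simp add: mult_right_mono)
      also have "\<dots> < e" using t B by (simp add: dist_real_def field_simps)
      finally show "dist (step n y t) (step n y s) < e" .
    qed (use e B in auto)
  qed
  define it where "it n k = (step n ^^ k) (\<lambda>_. z0)" for n k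
  have it_Suc: "it n (Suc k) = step n (it n k)" for n k by (simp add: it_def)
  have cont_it: "continuous_on {0..} (it n k)" for n k
  proof (induction k)
    case (Suc k)
    then show ?case by (simp only: it_Suc cont_step)
  qed (simp add: it_def)
  have agree: "it n (Suc k) t = it n k t" if "0 \<le> t" "t \<le> k * h n" for n k t
    using that
  proof (induction k arbitrary: t)
    case (Suc k)
    have "integral {0..t} (\<lambda>s. F (it n (Suc k) (max 0 (s - h n)))) =
        integral {0..t} (\<lambda>s. F (it n k (max 0 (s - h n))))"
      using Suc.prems h[of n] by (intro integral_cong arg_cong[of _ _ F] Suc.IH) (auto simp: algebra_simps)
    then show ?case by (subst (1 2) it_Suc) (simp add: step_def)
  qed (simp add: it_def step_def)
  \<comment> \<open>The number of iterations times \<open>h n\<close> is at least \<open>T\<close>,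
    so one more iteration changes nothing on \<open>{0..T}\<close>. The \<open>Suc\<close> also
    makes \<open>y n\<close> a value of \<open>step\<close>, to which the bound \<open>lip\<close>
    applies.\<close>
  define y where "y n = it n (Suc (nat \<lceil>T / h n\<rceil>))" for n
  have y_eq: "y n t = z0 + integral {0..t} (\<lambda>s. F (y n (max 0 (s - h n))))"
    if "0 \<le> t" "t \<le> T" for n t
  proof -
    have "T \<le> real (Suc (nat \<lceil>T / h n\<rceil>)) * h n"
    proof -
      have "T / h n \<le> real (Suc (nat \<lceil>T / h n\<rceil>))" by linarith
      then show ?thesis using h[of n] by (simp add: field_simps)
    qed
    then have "y n t = it n (Suc (Suc (nat \<lceil>T / h n\<rceil>))) t"
      unfolding y_def using agree that by (metis order_trans)
    then show ?thesis by (subst (asm) it_Suc) (simp add: step_def y_def)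
  qed
  have y_lip: "norm (y n t - y n s) \<le> B * \<bar>t - s\<bar>" if "0 \<le> s" "0 \<le> t" for n s t
    unfolding y_def it_Suc using lip[OF cont_it that] .
  have cont_y: "continuous_on {0..} (y n)" for n unfolding y_def by (rule cont_it)
  have y0: "y n 0 = z0" for n using y_eq[of 0 n] T by simp
  obtain g k where gk: "continuous_on {0..T} g" "strict_mono (k :: nat \<Rightarrow> nat)"
    "\<And>e. 0 < e \<Longrightarrow> \<exists>N. \<forall>n x. n \<ge> N \<and> x \<in> {0..T} \<longrightarrow> norm (y (k n) x - g x) < e"
  proof (rule Arzela_Ascoli[of "{0..T}" y "norm z0 + B * T"])
    show "norm (y n x) \<le> norm z0 + B * T" if "x \<in> {0..T}" for n x
    proof -
      have "norm (y n x) \<le> norm (y n 0) + norm (y n x - y n 0)" by (rule norm_triangle_sub)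
      also have "\<dots> \<le> norm z0 + B * T"
        using y_lip[of 0 x n] that y0 B mult_left_mono[of x T B] by auto
      finally show ?thesis .
    qed
    show "\<exists>d>0. \<forall>n r. r \<in> {0..T} \<and> norm (x - r) < d \<longrightarrow> norm (y n x - y n r) < e"
      if "x \<in> {0..T}" "0 < e" for x e
    proof (intro exI[of _ "e / (B + 1)"] conjI allI impI)
      fix n r assume r: "r \<in> {0..T} \<and> norm (x - r) < e / (B + 1)"
      have "norm (y n x - y n r) \<le> B * \<bar>x - r\<bar>" using y_lip that r by simp
      also have "\<dots> \<le> (B + 1) * \<bar>x - r\<bar>" by (simp add: mult_right_mono)
      also have "\<dots> < e" using r B by (simp add: field_simps)
      finally show "norm (y n x - y n r) < e" .
    qed (use that B in auto)
  qed (auto intro: that)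
  have lim: "(\<lambda>n. y (k n) t) \<longlonglongrightarrow> g t" if "t \<in> {0..T}" for t
    using gk(3) that unfolding LIMSEQ_iff by meson
  have h_lim: "(\<lambda>n. h (k n)) \<longlonglongrightarrow> 0"
  proof -
    have "h \<longlonglongrightarrow> 0" unfolding h_def using LIMSEQ_inverse_real_of_nat
      by (simp add: inverse_eq_divide add.commute)
    then show ?thesis using LIMSEQ_subseq_LIMSEQ[OF _ gk(2)] by (simp add: o_def)
  qed
  \<comment> \<open>The Lipschitz constant \<open>B\<close> is common to all approximations, so the
    delay costs at most \<open>B * h (k n)\<close> and disappears in the limit.\<close>
  have lim_delay: "(\<lambda>n. y (k n) (max 0 (s - h (k n)))) \<longlonglongrightarrow> g s" if s: "s \<in> {0..T}" for s
  proof -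
    have "(\<lambda>n. y (k n) (max 0 (s - h (k n))) - y (k n) s) \<longlonglongrightarrow> 0"
    proof (rule Lim_null_comparison[of _ "\<lambda>n. B * h (k n)"])
      show "\<forall>\<^sub>F n in sequentially. norm (y (k n) (max 0 (s - h (k n))) - y (k n) s) \<le> B * h (k n)"
      proof (intro always_eventually allI)
        fix n
        have "norm (y (k n) (max 0 (s - h (k n))) - y (k n) s) \<le> B * \<bar>max 0 (s - h (k n)) - s\<bar>"
          using y_lip[of s "max 0 (s - h (k n))" "k n"] s by simp
        also have "\<dots> \<le> B * h (k n)"
          using s h[of "k n"] B by (intro mult_left_mono) auto
        finally show "norm (y (k n) (max 0 (s - h (k n))) - y (k n) s) \<le> B * h (k n)" .
      qed
      show "(\<lambda>n. B * h (k n)) \<longlonglongrightarrow> 0" using tendsto_mult_left[OF h_lim, of B] by simp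
    qed
    from tendsto_add[OF this lim[OF s]] show ?thesis by simp
  qed
  have g_eq: "g t = z0 + integral {0..t} (\<lambda>s. F (g s))" if t: "t \<in> {0..T}" for t
  proof -
    have "(\<lambda>n. integral {0..t} (\<lambda>s. F (y (k n) (max 0 (s - h (k n)))))) \<longlonglongrightarrow> integral {0..t} (\<lambda>s. F (g s))"
    proof (rule dominated_convergence(2)[of _ _ "\<lambda>_. B"])
      show "(\<lambda>n. F (y (k n) (max 0 (s - h (k n))))) \<longlonglongrightarrow> F (g s)" if "s \<in> {0..t}" for s
        using F lim_delay[of s] that t
        by (intro isCont_tendsto_compose[of _ F]) (auto simp: continuous_on_eq_continuous_at)
    qed (use bound in \<open>auto intro: intF[OF cont_y]\<close>)
    then have "(\<lambda>n. z0 + integral {0..t} (\<lambda>s. F (y (k n) (max 0 (s - h (k n))))))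
        \<longlonglongrightarrow> z0 + integral {0..t} (\<lambda>s. F (g s))"
      by (intro tendsto_intros)
    moreover have "(\<lambda>n. y (k n) t) = (\<lambda>n. z0 + integral {0..t} (\<lambda>s. F (y (k n) (max 0 (s - h (k n))))))"
      using y_eq t by auto
    ultimately show ?thesis using lim[OF t] LIMSEQ_unique by metis
  qed
  show thesis
  proof (rule that[of g])
    show "g 0 = z0" using g_eq[of 0] T by simp
    fix t assume t: "t \<in> {0..T}"
    have "continuous_on {0..T} (\<lambda>s. F (g s))"
      by (rule continuous_on_compose2[OF F gk(1)]) auto
    then have "((\<lambda>t. integral {0..t} (\<lambda>s. F (g s))) has_vector_derivative F (g t)) (at t within {0..T})"
      using t by (rule integral_has_vector_derivative)
    then have "((\<lambda>t. z0 + integral {0..t} (\<lambda>s. F (g s))) has_vector_derivative F (g t)) (at t within {0..T})"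
      by (auto intro: derivative_eq_intros)
    then show "(g has_vector_derivative F (g t)) (at t within {0..T})"
      using t g_eq by (elim has_vector_derivative_transform[rotated 2]) auto
  qed
qed

subsection \<open>Energy and uniqueness of solutions\<close>

definition energy :: "real \<Rightarrow> real \<Rightarrow> real \<times> real \<Rightarrow> real" where
  "energy a b z = \<bar>fst z\<bar> powr b / b + \<bar>snd z\<bar> powr a / a"

text \<open>Derivatives within \<open>S\<close> give a meaning to solutions on compact intervals and
  half lines, from which paths are glued together.\<close>

definition solves :: "real \<Rightarrow> real \<Rightarrow> real \<Rightarrow> (real \<Rightarrow> real \<times> real) \<Rightarrow> real set \<Rightarrow> bool" where
  "solves a b \<gamma> z S \<longleftrightarrow>
     (\<forall>t\<in>S. (z has_vector_derivative damped_field a b \<gamma> (z t)) (at t within S))"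

lemma is_path_iff_solves: "is_path a b \<gamma> z \<longleftrightarrow> solves a b \<gamma> z UNIV"
  by (simp add: is_path_def solves_def)

lemma damped_field_eq:
  "damped_field a b \<gamma> z = (spow a (snd z), - spow b (fst z) - \<gamma> * snd z)"
  by (cases z) (simp add: damped_field_def spow_def)

lemma solves_fst:
  assumes "solves a b \<gamma> z S" "t \<in> S"
  shows "((\<lambda>t. fst (z t)) has_real_derivative spow a (snd (z t))) (at t within S)"
  using bounded_linear.has_vector_derivative[OF bounded_linear_fst, of z _ "at t within S"] assms
  unfolding solves_def has_real_derivative_iff_has_vector_derivative
  by (force simp: damped_field_eq)

lemma solves_snd:
  assumes "solves a b \<gamma> z S" "t \<in> S"
  shows "((\<lambda>t. snd (z t)) has_real_derivative - spow b (fst (z t)) - \<gamma> * snd (z t)) (at t within S)"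
  using bounded_linear.has_vector_derivative[OF bounded_linear_snd, of z _ "at t within S"] assms
  unfolding solves_def has_real_derivative_iff_has_vector_derivative
  by (force simp: damped_field_eq)

lemma solvesI:
  assumes "\<And>t. t \<in> S \<Longrightarrow> (x has_real_derivative spow a (p t)) (at t within S)"
    and "\<And>t. t \<in> S \<Longrightarrow> (p has_real_derivative - spow b (x t) - \<gamma> * p t) (at t within S)"
  shows "solves a b \<gamma> (\<lambda>t. (x t, p t)) S"
  unfolding solves_def damped_field_eq
  using assms by (auto intro!: has_vector_derivative_Pair
      simp: has_real_derivative_iff_has_vector_derivative)

lemma solves_subset: "solves a b \<gamma> z S \<Longrightarrow> R \<subseteq> S \<Longrightarrow> solves a b \<gamma> z R"
  unfolding solves_def by (meson has_vector_derivative_within_subset subsetD)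

lemma solves_continuous_on: "solves a b \<gamma> z S \<Longrightarrow> continuous_on S z"
  unfolding solves_def by (meson continuous_on_eq_continuous_within has_vector_derivative_continuous)

lemma solves_minus:
  assumes "solves a b \<gamma> z S"
  shows "solves a b \<gamma> (\<lambda>t. - z t) S"
proof -
  have "solves a b \<gamma> (\<lambda>t. (- fst (z t), - snd (z t))) S"
    by (rule solvesI) (auto intro!: derivative_eq_intros solves_fst[OF assms] solves_snd[OF assms])
  moreover have "(\<lambda>t. (- fst (z t), - snd (z t))) = (\<lambda>t. - z t)"
    by (auto simp: prod_eq_iff)
  ultimately show ?thesis by simp
qed

lemma solves_shift:
  assumes "solves a b \<gamma> z ((\<lambda>t. t + \<Delta>) ` S)"
  shows "solves a b \<gamma> (\<lambda>t. z (t + \<Delta>)) S"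
  unfolding solves_def
proof
  fix t assume "t \<in> S"
  then have "(z has_vector_derivative damped_field a b \<gamma> (z (t + \<Delta>)))
      (at (t + \<Delta>) within (\<lambda>t. t + \<Delta>) ` S)"
    using assms by (simp add: solves_def)
  moreover have "((\<lambda>t. t + \<Delta>) has_vector_derivative 1) (at t within S)"
    unfolding has_real_derivative_iff_has_vector_derivative[symmetric]
    by (auto intro!: derivative_eq_intros)
  ultimately show "((\<lambda>t. z (t + \<Delta>)) has_vector_derivative damped_field a b \<gamma> (z (t + \<Delta>))) (at t within S)"
    using vector_diff_chain_within[of "\<lambda>t. t + \<Delta>" 1 t S] by (force simp: o_def)
qed

text \<open>Reversing time and momentum preserves the conservative part and changes only the sign of
  the friction. Existence and uniqueness are therefore proved forwards for \<open>\<gamma>\<close>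
  of any sign, and the backward statements follow.\<close>

lemma solves_reverse:
  assumes "solves a b \<gamma> z (uminus ` S)"
  shows "solves a b (- \<gamma>) (\<lambda>t. (fst (z (- t)), - snd (z (- t)))) S"
proof (rule solvesI)
  fix t assume "t \<in> S"
  then have t: "- t \<in> uminus ` S" by simp
  have 1: "(uminus has_real_derivative -1) (at t within S)"
    by (auto intro!: derivative_eq_intros)
  show "((\<lambda>t. fst (z (- t))) has_real_derivative spow a (- snd (z (- t)))) (at t within S)"
    using DERIV_image_chain[OF solves_fst[OF assms t] 1] by (simp add: o_def)
  show "((\<lambda>t. - snd (z (- t))) has_real_derivative
      - spow b (fst (z (- t))) - - \<gamma> * - snd (z (- t))) (at t within S)"
    by (rule DERIV_cong[OF DERIV_minus[OF DERIV_image_chain[OF solves_snd[OF assms t] 1],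
            unfolded o_def]]) simp
qed

lemma powr_lipschitz:
  fixes e lo hi :: real
  assumes "0 < lo"
  obtains L where "L \<ge> 0"
    and "\<And>x y. x \<in> {lo..hi} \<Longrightarrow> y \<in> {lo..hi} \<Longrightarrow> \<bar>x powr e - y powr e\<bar> \<le> L * \<bar>x - y\<bar>"
proof
  \<comment> \<open>The derivative is monotone in a direction that depends on \<open>e\<close>; the
    sum of its two end values covers both cases.\<close>
  define L where "L = \<bar>e\<bar> * (lo powr (e - 1) + hi powr (e - 1))"
  show "L \<ge> 0" by (simp add: L_def)
  fix x y assume xy: "x \<in> {lo..hi}" "y \<in> {lo..hi}"
  have "norm (x powr e - y powr e) \<le> L * norm (x - y)"
  proof (rule field_differentiable_bound[OF _ _ _ xy])
    fix u assume u: "u \<in> {lo..hi}"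
    show "((\<lambda>u. u powr e) has_real_derivative e * u powr (e - 1)) (at u within {lo..hi})"
      using u assms by (auto intro!: derivative_eq_intros)
    have "u powr (e - 1) \<le> lo powr (e - 1) + hi powr (e - 1)"
    proof (cases "e \<ge> 1")
      case True
      then have "u powr (e - 1) \<le> hi powr (e - 1)" using u assms by (intro powr_mono2) auto
      then show ?thesis by (simp add: add_increasing)
    next
      case False
      then have "u powr (e - 1) \<le> lo powr (e - 1)" using u assms by (intro powr_mono2') auto
      then show ?thesis by (simp add: add_increasing2)
    qed
    then show "norm (e * u powr (e - 1)) \<le> L"
      by (simp add: L_def abs_mult mult_left_mono)
  qed simp
  then show "\<bar>x powr e - y powr e\<bar> \<le> L * \<bar>x - y\<bar>" by simp
qed

lemma abs_powr_lipschitz: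
  fixes c R :: real
  assumes "c > 1" and "\<bar>p\<bar> \<le> R" "\<bar>r\<bar> \<le> R"
  shows "\<bar>\<bar>p\<bar> powr c / c - \<bar>r\<bar> powr c / c\<bar> \<le> R powr (c - 1) * \<bar>p - r\<bar>"
proof -
  have "norm (\<bar>p\<bar> powr c / c - \<bar>r\<bar> powr c / c) \<le> R powr (c - 1) * norm (p - r)"
  proof (rule field_differentiable_bound[of "{-R..R}"])
    show "((\<lambda>u. \<bar>u\<bar> powr c / c) has_real_derivative spow c u) (at u within {-R..R})" for u
      using abs_powr_has_derivative[OF assms(1)] .
    show "norm (spow c u) \<le> R powr (c - 1)" if "u \<in> {-R..R}" for u
      using that assms(1) by (auto simp: abs_spow intro!: powr_mono2)
  qed (use assms in auto)
  then show ?thesis by simp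
qed

text \<open>The derivative is at least its value at \<open>lo\<close>. This inverse Lipschitz bound
  recovers a difference of positions or momenta from a difference of potential or kinetic
  energies.\<close>

lemma powr_expansive:
  fixes c lo :: real
  assumes "c > 1" "lo > 0" "lo \<le> x" "lo \<le> y"
  shows "lo powr (c - 1) * \<bar>x - y\<bar> \<le> \<bar>x powr c / c - y powr c / c\<bar>"
proof -
  have *: "lo powr (c - 1) * (y - x) \<le> y powr c / c - x powr c / c" if "lo \<le> x" "x \<le> y" for x y
  proof -
    have "x powr c / c - lo powr (c - 1) * x \<le> y powr c / c - lo powr (c - 1) * y"
    proof (rule nondecreasing_within[OF \<open>x \<le> y\<close> subset_UNIV])
      fix u assume "u \<in> {x..y}"
      then have u: "lo \<le> u" using that by simp
      then show "((\<lambda>u. u powr c / c - lo powr (c - 1) * u) has_real_derivative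
          u powr (c - 1) - lo powr (c - 1)) (at u)"
        using assms by (auto intro!: derivative_eq_intros)
      show "0 \<le> u powr (c - 1) - lo powr (c - 1)"
        using u assms by (auto intro: powr_mono2)
    qed
    then show ?thesis by (simp add: algebra_simps)
  qed
  show ?thesis
    using *[of x y] *[of y x] assms by (cases "x \<le> y") (auto simp: abs_if algebra_simps)
qed

text \<open>The squared distance \<open>D\<close> of the two pairs is differentiable, unlike the
  distance, and satisfies \<open>D' \<le> 4 * K * D\<close> because (A + W)^2 is at most 2 (A^2 +
  W^2).\<close>

lemma gronwall_pair_eq:
  fixes e1 e2 w1 w2 :: "real \<Rightarrow> real"
  assumes e1: "\<And>t. t \<in> {s..u} \<Longrightarrow> (e1 has_real_derivative e1' t) (at t within {s..u})"
    and e2: "\<And>t. t \<in> {s..u} \<Longrightarrow> (e2 has_real_derivative e2' t) (at t within {s..u})"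
    and w1: "\<And>t. t \<in> {s..u} \<Longrightarrow> (w1 has_real_derivative w1' t) (at t within {s..u})"
    and w2: "\<And>t. t \<in> {s..u} \<Longrightarrow> (w2 has_real_derivative w2' t) (at t within {s..u})"
    and le_e: "\<And>t. t \<in> {s..u} \<Longrightarrow> \<bar>e1' t - e2' t\<bar> \<le> K * (\<bar>e1 t - e2 t\<bar> + \<bar>w1 t - w2 t\<bar>)"
    and le_w: "\<And>t. t \<in> {s..u} \<Longrightarrow> \<bar>w1' t - w2' t\<bar> \<le> K * (\<bar>e1 t - e2 t\<bar> + \<bar>w1 t - w2 t\<bar>)"
    and K: "K \<ge> 0" and "e1 s = e2 s" "w1 s = w2 s" and t: "t \<in> {s..u}"
  shows "e1 t = e2 t \<and> w1 t = w2 t"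
proof -
  define D where "D t = (e1 t - e2 t)\<^sup>2 + (w1 t - w2 t)\<^sup>2" for t
  have "D t \<le> 0"
  proof (rule gronwall_zero[of s t "{s..u}" D _ "4 * K"])
    fix r assume "r \<in> {s..t}"
    then have r: "r \<in> {s..u}" using t by simp
    show "(D has_real_derivative 2 * (e1 r - e2 r) * (e1' r - e2' r)
        + 2 * (w1 r - w2 r) * (w1' r - w2' r)) (at r within {s..u})"
      unfolding D_def
      by (rule derivative_eq_intros e1[OF r] e2[OF r] w1[OF r] w2[OF r] refl)+
        (simp add: algebra_simps)
    define A W where "A = \<bar>e1 r - e2 r\<bar>" and "W = \<bar>w1 r - w2 r\<bar>"
    have nn: "A \<ge> 0" "W \<ge> 0" by (simp_all add: A_def W_def)
    have "(e1 r - e2 r) * (e1' r - e2' r) \<le> A * (K * (A + W))"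
    proof -
      have "(e1 r - e2 r) * (e1' r - e2' r) \<le> A * \<bar>e1' r - e2' r\<bar>"
        using abs_ge_self[of "(e1 r - e2 r) * (e1' r - e2' r)"] by (simp add: A_def abs_mult)
      then show ?thesis
        using mult_left_mono[OF le_e[OF r] nn(1)] by (simp add: A_def W_def)
    qed
    moreover have "(w1 r - w2 r) * (w1' r - w2' r) \<le> W * (K * (A + W))"
    proof -
      have "(w1 r - w2 r) * (w1' r - w2' r) \<le> W * \<bar>w1' r - w2' r\<bar>"
        using abs_ge_self[of "(w1 r - w2 r) * (w1' r - w2' r)"] by (simp add: W_def abs_mult)
      then show ?thesis
        using mult_left_mono[OF le_w[OF r] nn(2)] by (simp add: A_def W_def)
    qed
    moreover have "2 * (A * (K * (A + W))) + 2 * (W * (K * (A + W))) \<le> 4 * K * (A\<^sup>2 + W\<^sup>2)"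
    proof -
      have "2 * (A + W)\<^sup>2 \<le> 4 * (A\<^sup>2 + W\<^sup>2)"
        using sum_squares_bound[of A W] by (simp add: power2_eq_square algebra_simps)
      from mult_left_mono[OF this K] show ?thesis by (simp add: power2_eq_square algebra_simps)
    qed
    ultimately show "2 * (e1 r - e2 r) * (e1' r - e2' r) + 2 * (w1 r - w2 r) * (w1' r - w2' r)
        \<le> 4 * K * D r"
      by (simp only: D_def A_def W_def power2_abs mult.assoc)
  qed (use t assms in \<open>auto simp: D_def\<close>)
  then show ?thesis
    by (simp add: D_def sum_power2_le_zero_iff)
qed

locale exponents =
  fixes a b :: real
  assumes a: "a > 1" and b: "b > 1"
begin

lemma energy_nonneg: "energy a b z \<ge> 0"
  using a b by (simp add: energy_def)

lemma energy_eq_0_iff: "energy a b z = 0 \<longleftrightarrow> z = 0"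
  using a b by (auto simp: energy_def add_nonneg_eq_0_iff prod_eq_iff)

text \<open>The conservative terms cancel and only friction remains. The factor \<open>c\<close>
  stands for the current value of a cutoff.\<close>

lemma energy_has_derivative_scaled:
  assumes z: "(z has_vector_derivative c *\<^sub>R damped_field a b \<gamma> (z t)) (at t within S)"
  shows "((\<lambda>t. energy a b (z t)) has_real_derivative - (c * \<gamma>) * \<bar>snd (z t)\<bar> powr a) (at t within S)"
proof -
  have f: "((\<lambda>t. fst (z t)) has_real_derivative c * spow a (snd (z t))) (at t within S)"
    using bounded_linear.has_vector_derivative[OF bounded_linear_fst z]
    by (simp add: has_real_derivative_iff_has_vector_derivative damped_field_eq)
  have g: "((\<lambda>t. snd (z t)) has_real_derivative
      c * (- spow b (fst (z t)) - \<gamma> * snd (z t))) (at t within S)"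
    using bounded_linear.has_vector_derivative[OF bounded_linear_snd z]
    by (simp add: has_real_derivative_iff_has_vector_derivative damped_field_eq)
  have "((\<lambda>t. energy a b (z t)) has_real_derivative
      spow b (fst (z t)) * (c * spow a (snd (z t)))
      + spow a (snd (z t)) * (c * (- spow b (fst (z t)) - \<gamma> * snd (z t)))) (at t within S)"
    unfolding energy_def
    by (intro DERIV_add DERIV_chain2[OF abs_powr_has_derivative[OF b]]
        DERIV_chain2[OF abs_powr_has_derivative[OF a]] f g)
  moreover have "spow b (fst (z t)) * (c * spow a (snd (z t)))
      + spow a (snd (z t)) * (c * (- spow b (fst (z t)) - \<gamma> * snd (z t)))
      = - (c * \<gamma>) * \<bar>snd (z t)\<bar> powr a"
    by (simp add: spow_mult_self[OF a, symmetric] algebra_simps)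
  ultimately show ?thesis by simp
qed

lemma energy_has_derivative:
  assumes "solves a b \<gamma> z S" "t \<in> S"
  shows "((\<lambda>t. energy a b (z t)) has_real_derivative - \<gamma> * \<bar>snd (z t)\<bar> powr a) (at t within S)"
  using energy_has_derivative_scaled[of z 1 \<gamma> t S] assms by (simp add: solves_def)

lemma abs_snd_powr_le_energy: "\<bar>snd z\<bar> powr a \<le> a * energy a b z"
  using a b by (simp add: energy_def distrib_left)

lemma abs_fst_powr_le_energy: "\<bar>fst z\<bar> powr b \<le> b * energy a b z"
  using a b by (simp add: energy_def distrib_left)

text \<open>Kinetic energy is part of the energy, so the energy changes at a relative rate of at
  most \<open>a * G\<close>. The upper bound excludes blow-up, the lower one excludes arrival at the
  origin. The variable friction \<open>g\<close> allows for a cutoff.\<close>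

lemma energy_growth:
  assumes E: "\<And>t. t \<in> S \<Longrightarrow> ((\<lambda>t. energy a b (z t)) has_real_derivative - g t * \<bar>snd (z t)\<bar> powr a) (at t within S)"
    and g: "\<And>t. t \<in> S \<Longrightarrow> \<bar>g t\<bar> \<le> G"
    and "s \<le> t" "{s..t} \<subseteq> S"
  shows "energy a b (z t) \<le> energy a b (z s) * exp (a * G * (t - s))"
    and "energy a b (z s) * exp (- a * G * (t - s)) \<le> energy a b (z t)"
proof -
  have bnd: "\<bar>g r * \<bar>snd (z r)\<bar> powr a\<bar> \<le> a * G * energy a b (z r)" if "r \<in> S" for r
  proof -
    have "\<bar>g r\<bar> * \<bar>snd (z r)\<bar> powr a \<le> G * (a * energy a b (z r))"
      using g[OF that] abs_snd_powr_le_energy energy_nonneg by (intro mult_mono) auto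
    then show ?thesis by (simp add: abs_mult mult_ac)
  qed
  have "energy a b (z t) * exp (- (a * G) * t) \<le> energy a b (z s) * exp (- (a * G) * s)"
  proof (rule nonincreasing_within[OF assms(3,4)])
    fix r assume "r \<in> {s..t}"
    then have r: "r \<in> S" using assms by auto
    show "((\<lambda>r. energy a b (z r) * exp (- (a * G) * r)) has_real_derivative
      (- g r * \<bar>snd (z r)\<bar> powr a - a * G * energy a b (z r)) * exp (- (a * G) * r)) (at r within S)"
      by (rule derivative_eq_intros E[OF r] refl)+ (simp add: algebra_simps)
    show "(- g r * \<bar>snd (z r)\<bar> powr a - a * G * energy a b (z r)) * exp (- (a * G) * r) \<le> 0"
      using bnd[OF r] by (simp add: mult_le_0_iff abs_le_iff)
  qed
  from mult_right_mono[OF this, of "exp (a * G * t)"]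
  show "energy a b (z t) \<le> energy a b (z s) * exp (a * G * (t - s))"
    by (simp add: mult.assoc flip: exp_add) (simp add: algebra_simps)
  have "energy a b (z s) * exp (a * G * s) \<le> energy a b (z t) * exp (a * G * t)"
  proof (rule nondecreasing_within[OF assms(3,4)])
    fix r assume "r \<in> {s..t}"
    then have r: "r \<in> S" using assms by auto
    show "((\<lambda>r. energy a b (z r) * exp (a * G * r)) has_real_derivative
      (- g r * \<bar>snd (z r)\<bar> powr a + a * G * energy a b (z r)) * exp (a * G * r)) (at r within S)"
      by (rule derivative_eq_intros E[OF r] refl)+ (simp add: algebra_simps)
    show "0 \<le> (- g r * \<bar>snd (z r)\<bar> powr a + a * G * energy a b (z r)) * exp (a * G * r)"
      using bnd[OF r] by (simp add: abs_le_iff)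
  qed
  from mult_right_mono[OF this, of "exp (- a * G * t)"]
  show "energy a b (z s) * exp (- a * G * (t - s)) \<le> energy a b (z t)"
    by (simp add: mult.assoc flip: exp_add) (simp add: algebra_simps)
qed

text \<open>The origin is the only state near which neither coordinate is bounded away from 0, so
  this keeps the local uniqueness arguments available at all later times.\<close>

lemma solves_nonzero:
  assumes "solves a b \<gamma> z {s..u}" "z s \<noteq> 0" "t \<in> {s..u}"
  shows "z t \<noteq> 0"
proof -
  have "0 < energy a b (z s) * exp (- a * \<bar>\<gamma>\<bar> * (t - s))"
    using energy_nonneg[of "z s"] energy_eq_0_iff[of "z s"] assms(2) by simp
  also have "\<dots> \<le> energy a b (z t)"
    using energy_has_derivative[OF assms(1)] assms(3)
    by (intro energy_growth(2)[of "{s..u}" z "\<lambda>_. \<gamma>"]) auto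
  finally show ?thesis using energy_eq_0_iff[of "z t"] by auto
qed

text \<open>Where \<open>x\<close> is bounded away from \<open>0\<close>, the system is Lipschitz in the coordinates
  energy and \<open>p\<close>, although it need not be Lipschitz in \<open>(x, p)\<close> when \<open>a < 2\<close>.\<close>

lemma solves_eq_fst_pos:
  assumes z: "solves a b \<gamma> z {s..u}" and w: "solves a b \<gamma> w {s..u}" and "z s = w s" and "0 < lo"
    and zb: "\<And>t. t \<in> {s..u} \<Longrightarrow> fst (z t) \<in> {lo..hi} \<and> \<bar>snd (z t)\<bar> \<le> R"
    and wb: "\<And>t. t \<in> {s..u} \<Longrightarrow> fst (w t) \<in> {lo..hi} \<and> \<bar>snd (w t)\<bar> \<le> R"
    and t: "t \<in> {s..u}"
  shows "z t = w t"
proof -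
  obtain L where L: "L \<ge> 0" "\<And>x y. x \<in> {lo..hi} \<Longrightarrow> y \<in> {lo..hi} \<Longrightarrow>
      \<bar>x powr (b - 1) - y powr (b - 1)\<bar> \<le> L * \<bar>x - y\<bar>"
    using powr_lipschitz[OF \<open>0 < lo\<close>, of "hi" "b - 1"] by blast
  define l where "l = lo powr (b - 1)"
  have l: "l > 0" using \<open>0 < lo\<close> by (simp add: l_def)
  define r where "r = R powr (a - 1)"
  have r: "r \<ge> 0" by (simp add: r_def)
  \<comment> \<open>The first summand bounds the difference of the energy derivatives, the other two
    that of the momentum derivatives, after \<open>pos\<close> has removed the positions.\<close>
  define K where "K = \<bar>\<gamma>\<bar> * (a * r) + L * ((1 + r) / l) + \<bar>\<gamma>\<bar>"
  have kin: "\<bar>\<bar>snd (z t)\<bar> powr a / a - \<bar>snd (w t)\<bar> powr a / a\<bar> \<le> r * \<bar>snd (z t) - snd (w t)\<bar>"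
    if "t \<in> {s..u}" for t
    using abs_powr_lipschitz[OF a, of "snd (z t)" R "snd (w t)"] zb[OF that] wb[OF that]
    by (simp add: r_def)
  \<comment> \<open>Subtracting the kinetic part from the energy leaves the potential energy, which
    can be inverted where \<open>x \<ge> lo\<close>.\<close>
  have pos: "\<bar>fst (z t) - fst (w t)\<bar> \<le>
      (1 + r) / l * (\<bar>energy a b (z t) - energy a b (w t)\<bar> + \<bar>snd (z t) - snd (w t)\<bar>)"
    if "t \<in> {s..u}" for t
  proof -
    have "l * \<bar>fst (z t) - fst (w t)\<bar> \<le> \<bar>fst (z t) powr b / b - fst (w t) powr b / b\<bar>"
      unfolding l_def using powr_expansive[OF b \<open>0 < lo\<close>] zb[OF that] wb[OF that] by simp
    also have "\<dots> \<le> \<bar>energy a b (z t) - energy a b (w t)\<bar> + r * \<bar>snd (z t) - snd (w t)\<bar>"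
      using kin[OF that] zb[OF that] wb[OF that] \<open>0 < lo\<close> by (simp add: energy_def) linarith
    also have "\<dots> \<le> (1 + r) * (\<bar>energy a b (z t) - energy a b (w t)\<bar> + \<bar>snd (z t) - snd (w t)\<bar>)"
      using r by (simp add: algebra_simps)
    finally show ?thesis using l by (simp add: field_simps)
  qed
  have "energy a b (z t) = energy a b (w t) \<and> snd (z t) = snd (w t)"
  proof (rule gronwall_pair_eq[of s u "\<lambda>t. energy a b (z t)" "\<lambda>t. - \<gamma> * \<bar>snd (z t)\<bar> powr a"
        "\<lambda>t. energy a b (w t)" "\<lambda>t. - \<gamma> * \<bar>snd (w t)\<bar> powr a"
        "\<lambda>t. snd (z t)" "\<lambda>t. - spow b (fst (z t)) - \<gamma> * snd (z t)"
        "\<lambda>t. snd (w t)" "\<lambda>t. - spow b (fst (w t)) - \<gamma> * snd (w t)" K])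
    fix t assume t: "t \<in> {s..u}"
    show "((\<lambda>t. energy a b (z t)) has_real_derivative - \<gamma> * \<bar>snd (z t)\<bar> powr a) (at t within {s..u})"
      "((\<lambda>t. energy a b (w t)) has_real_derivative - \<gamma> * \<bar>snd (w t)\<bar> powr a) (at t within {s..u})"
      using energy_has_derivative[OF z t] energy_has_derivative[OF w t] .
    show "((\<lambda>t. snd (z t)) has_real_derivative - spow b (fst (z t)) - \<gamma> * snd (z t)) (at t within {s..u})"
      "((\<lambda>t. snd (w t)) has_real_derivative - spow b (fst (w t)) - \<gamma> * snd (w t)) (at t within {s..u})"
      using solves_snd[OF z t] solves_snd[OF w t] .
    define A W where "A = \<bar>energy a b (z t) - energy a b (w t)\<bar>" and "W = \<bar>snd (z t) - snd (w t)\<bar>"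
    have nn: "A \<ge> 0" "W \<ge> 0" by (simp_all add: A_def W_def)
    have "- \<gamma> * \<bar>snd (z t)\<bar> powr a - - \<gamma> * \<bar>snd (w t)\<bar> powr a
        = - (\<gamma> * (a * (\<bar>snd (z t)\<bar> powr a / a - \<bar>snd (w t)\<bar> powr a / a)))"
      using a by (simp add: field_simps)
    then have "\<bar>- \<gamma> * \<bar>snd (z t)\<bar> powr a - - \<gamma> * \<bar>snd (w t)\<bar> powr a\<bar>
        = \<bar>\<gamma>\<bar> * (a * \<bar>\<bar>snd (z t)\<bar> powr a / a - \<bar>snd (w t)\<bar> powr a / a\<bar>)"
      using a by (simp only: abs_minus_cancel abs_mult) simp
    also have "\<dots> \<le> \<bar>\<gamma>\<bar> * (a * (r * W))"
      using kin[OF t] a by (intro mult_left_mono) (auto simp: W_def)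
    also have "\<dots> = \<bar>\<gamma>\<bar> * (a * r) * W" by simp
    also have "\<dots> \<le> K * (A + W)"
      using nn a L(1) l r by (intro mult_mono) (auto simp: K_def)
    finally show "\<bar>- \<gamma> * \<bar>snd (z t)\<bar> powr a - - \<gamma> * \<bar>snd (w t)\<bar> powr a\<bar>
        \<le> K * (\<bar>energy a b (z t) - energy a b (w t)\<bar> + \<bar>snd (z t) - snd (w t)\<bar>)"
      unfolding A_def W_def .
    have "\<bar>(- spow b (fst (z t)) - \<gamma> * snd (z t)) - (- spow b (fst (w t)) - \<gamma> * snd (w t))\<bar>
        \<le> \<bar>fst (z t) powr (b - 1) - fst (w t) powr (b - 1)\<bar> + \<bar>\<gamma>\<bar> * W"
    proof -
      have "(- spow b (fst (z t)) - \<gamma> * snd (z t)) - (- spow b (fst (w t)) - \<gamma> * snd (w t))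
          = - (fst (z t) powr (b - 1) - fst (w t) powr (b - 1)) - \<gamma> * (snd (z t) - snd (w t))"
        using zb[OF t] wb[OF t] \<open>0 < lo\<close> by (simp add: spow_pos algebra_simps)
      then show ?thesis
        using abs_triangle_ineq4[of "- (fst (z t) powr (b - 1) - fst (w t) powr (b - 1))"
            "\<gamma> * (snd (z t) - snd (w t))"]
        by (simp only: W_def abs_mult abs_minus_cancel)
    qed
    also have "\<dots> \<le> L * \<bar>fst (z t) - fst (w t)\<bar> + \<bar>\<gamma>\<bar> * W"
      using L(2) zb[OF t] wb[OF t] by simp
    also have "\<dots> \<le> L * ((1 + r) / l * (A + W)) + \<bar>\<gamma>\<bar> * (A + W)"
      using pos[OF t] L(1) nn by (intro add_mono mult_left_mono) (auto simp: A_def W_def)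
    also have "\<dots> = (L * ((1 + r) / l) + \<bar>\<gamma>\<bar>) * (A + W)" by (simp add: algebra_simps)
    also have "\<dots> \<le> K * (A + W)"
      using nn a r by (intro mult_right_mono) (auto simp: K_def)
    finally show "\<bar>(- spow b (fst (z t)) - \<gamma> * snd (z t)) - (- spow b (fst (w t)) - \<gamma> * snd (w t))\<bar>
        \<le> K * (\<bar>energy a b (z t) - energy a b (w t)\<bar> + \<bar>snd (z t) - snd (w t)\<bar>)"
      unfolding A_def W_def .
  qed (use t assms(3) a L(1) l r in \<open>auto simp: K_def\<close>)
  then have "fst (z t) = fst (w t)" "snd (z t) = snd (w t)" using pos[OF t] by auto
  then show ?thesis by (simp add: prod_eq_iff)
qed

text \<open>Here energy and \<open>x\<close> serve as coordinates. Their derivatives depend on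
  \<open>p\<close> alone, and \<open>p \<ge> lo\<close>, so the force, which need not be Lipschitz
  at \<open>x = 0\<close>, never has to be estimated.\<close>

lemma solves_eq_snd_pos:
  assumes z: "solves a b \<gamma> z {s..u}" and w: "solves a b \<gamma> w {s..u}" and "z s = w s" and "0 < lo"
    and zb: "\<And>t. t \<in> {s..u} \<Longrightarrow> snd (z t) \<in> {lo..hi} \<and> \<bar>fst (z t)\<bar> \<le> R"
    and wb: "\<And>t. t \<in> {s..u} \<Longrightarrow> snd (w t) \<in> {lo..hi} \<and> \<bar>fst (w t)\<bar> \<le> R"
    and t: "t \<in> {s..u}"
  shows "z t = w t"
proof -
  obtain L where L: "L \<ge> 0" "\<And>x y. x \<in> {lo..hi} \<Longrightarrow> y \<in> {lo..hi} \<Longrightarrow>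
      \<bar>x powr (a - 1) - y powr (a - 1)\<bar> \<le> L * \<bar>x - y\<bar>"
    using powr_lipschitz[OF \<open>0 < lo\<close>, of "hi" "a - 1"] by blast
  obtain M where M: "M \<ge> 0" "\<And>x y. x \<in> {lo..hi} \<Longrightarrow> y \<in> {lo..hi} \<Longrightarrow>
      \<bar>x powr a - y powr a\<bar> \<le> M * \<bar>x - y\<bar>"
    using powr_lipschitz[OF \<open>0 < lo\<close>, of "hi" a] by blast
  define l where "l = lo powr (a - 1)"
  have l: "l > 0" using \<open>0 < lo\<close> by (simp add: l_def)
  define r where "r = R powr (b - 1)"
  have r: "r \<ge> 0" by (simp add: r_def)
  define K where "K = \<bar>\<gamma>\<bar> * M * ((1 + r) / l) + L * ((1 + r) / l)"
  have pot: "\<bar>\<bar>fst (z t)\<bar> powr b / b - \<bar>fst (w t)\<bar> powr b / b\<bar> \<le> r * \<bar>fst (z t) - fst (w t)\<bar>"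
    if "t \<in> {s..u}" for t
    using abs_powr_lipschitz[OF b, of "fst (z t)" R "fst (w t)"] zb[OF that] wb[OF that]
    by (simp add: r_def)
  have pos: "\<bar>snd (z t) - snd (w t)\<bar> \<le>
      (1 + r) / l * (\<bar>energy a b (z t) - energy a b (w t)\<bar> + \<bar>fst (z t) - fst (w t)\<bar>)"
    if "t \<in> {s..u}" for t
  proof -
    have "l * \<bar>snd (z t) - snd (w t)\<bar> \<le> \<bar>snd (z t) powr a / a - snd (w t) powr a / a\<bar>"
      unfolding l_def using powr_expansive[OF a \<open>0 < lo\<close>] zb[OF that] wb[OF that] by simp
    also have "\<dots> \<le> \<bar>energy a b (z t) - energy a b (w t)\<bar> + r * \<bar>fst (z t) - fst (w t)\<bar>"
      using pot[OF that] zb[OF that] wb[OF that] \<open>0 < lo\<close> by (simp add: energy_def) linarith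
    also have "\<dots> \<le> (1 + r) * (\<bar>energy a b (z t) - energy a b (w t)\<bar> + \<bar>fst (z t) - fst (w t)\<bar>)"
      using r by (simp add: algebra_simps)
    finally show ?thesis using l by (simp add: field_simps)
  qed
  have "energy a b (z t) = energy a b (w t) \<and> fst (z t) = fst (w t)"
  proof (rule gronwall_pair_eq[of s u "\<lambda>t. energy a b (z t)" "\<lambda>t. - \<gamma> * \<bar>snd (z t)\<bar> powr a"
        "\<lambda>t. energy a b (w t)" "\<lambda>t. - \<gamma> * \<bar>snd (w t)\<bar> powr a"
        "\<lambda>t. fst (z t)" "\<lambda>t. spow a (snd (z t))" "\<lambda>t. fst (w t)" "\<lambda>t. spow a (snd (w t))" K])
    fix t assume t: "t \<in> {s..u}"
    show "((\<lambda>t. energy a b (z t)) has_real_derivative - \<gamma> * \<bar>snd (z t)\<bar> powr a) (at t within {s..u})"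
      "((\<lambda>t. energy a b (w t)) has_real_derivative - \<gamma> * \<bar>snd (w t)\<bar> powr a) (at t within {s..u})"
      using energy_has_derivative[OF z t] energy_has_derivative[OF w t] .
    show "((\<lambda>t. fst (z t)) has_real_derivative spow a (snd (z t))) (at t within {s..u})"
      "((\<lambda>t. fst (w t)) has_real_derivative spow a (snd (w t))) (at t within {s..u})"
      using solves_fst[OF z t] solves_fst[OF w t] .
    define A W where "A = \<bar>energy a b (z t) - energy a b (w t)\<bar>" and "W = \<bar>fst (z t) - fst (w t)\<bar>"
    have nn: "A \<ge> 0" "W \<ge> 0" by (simp_all add: A_def W_def)
    have "- \<gamma> * \<bar>snd (z t)\<bar> powr a - - \<gamma> * \<bar>snd (w t)\<bar> powr a
        = - (\<gamma> * (snd (z t) powr a - snd (w t) powr a))"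
      using zb[OF t] wb[OF t] \<open>0 < lo\<close> by (simp add: algebra_simps)
    then have "\<bar>- \<gamma> * \<bar>snd (z t)\<bar> powr a - - \<gamma> * \<bar>snd (w t)\<bar> powr a\<bar>
        = \<bar>\<gamma>\<bar> * \<bar>snd (z t) powr a - snd (w t) powr a\<bar>"
      by (simp only: abs_minus_cancel abs_mult)
    also have "\<dots> \<le> \<bar>\<gamma>\<bar> * (M * ((1 + r) / l * (A + W)))"
      using M(2)[of "snd (z t)" "snd (w t)"] mult_left_mono[OF pos[OF t] M(1)] zb[OF t] wb[OF t]
      by (intro mult_left_mono) (auto simp: A_def W_def)
    also have "\<dots> = (\<bar>\<gamma>\<bar> * M * ((1 + r) / l)) * (A + W)" by simp
    also have "\<dots> \<le> K * (A + W)"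
      using nn L(1) l r by (intro mult_right_mono) (auto simp: K_def)
    finally show "\<bar>- \<gamma> * \<bar>snd (z t)\<bar> powr a - - \<gamma> * \<bar>snd (w t)\<bar> powr a\<bar>
        \<le> K * (\<bar>energy a b (z t) - energy a b (w t)\<bar> + \<bar>fst (z t) - fst (w t)\<bar>)"
      unfolding A_def W_def .
    have "\<bar>spow a (snd (z t)) - spow a (snd (w t))\<bar> \<le> L * ((1 + r) / l * (A + W))"
      using L(2)[of "snd (z t)" "snd (w t)"] mult_left_mono[OF pos[OF t] L(1)] zb[OF t] wb[OF t]
        \<open>0 < lo\<close> by (simp add: A_def W_def spow_pos)
    also have "\<dots> = (L * ((1 + r) / l)) * (A + W)" by simp
    also have "\<dots> \<le> K * (A + W)"
      using nn M(1) l r by (intro mult_right_mono) (auto simp: K_def)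
    finally show "\<bar>spow a (snd (z t)) - spow a (snd (w t))\<bar>
        \<le> K * (\<bar>energy a b (z t) - energy a b (w t)\<bar> + \<bar>fst (z t) - fst (w t)\<bar>)"
      unfolding A_def W_def .
  qed (use t assms(3) M(1) L(1) l r in \<open>auto simp: K_def\<close>)
  then have "fst (z t) = fst (w t)" "snd (z t) = snd (w t)" using pos[OF t] by auto
  then show ?thesis by (simp add: prod_eq_iff)
qed

text \<open>By continuity both solutions stay for a short time in a box where the positive
  coordinate keeps at least half of its initial value, and one of the two Lipschitz arguments
  applies there.\<close>

lemma solves_eq_locally:
  assumes z: "solves a b \<gamma> z {s..u}" and w: "solves a b \<gamma> w {s..u}" and "z s = w s"
    and "s < u" and "fst (z s) > 0 \<or> snd (z s) > 0"
  shows "\<exists>e>0. \<forall>r. s \<le> r \<and> r < s + e \<and> r \<le> u \<longrightarrow> z r = w r"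
proof -
  define R where "R = \<bar>fst (z s)\<bar> + \<bar>snd (z s)\<bar> + 1"
  have "\<forall>\<^sub>F r in at s within {s..u}. \<bar>fst (y r)\<bar> < R \<and> \<bar>snd (y r)\<bar> < R
      \<and> (fst (y s) > 0 \<longrightarrow> fst (y s) / 2 < fst (y r))
      \<and> (snd (y s) > 0 \<longrightarrow> snd (y s) / 2 < snd (y r))"
    if y: "solves a b \<gamma> y {s..u}" and ys: "y s = z s" for y
  proof -
    have "(y \<longlongrightarrow> y s) (at s within {s..u})"
      using solves_continuous_on[OF y] \<open>s < u\<close> by (simp add: continuous_on_def)
    then have f: "((\<lambda>r. fst (y r)) \<longlongrightarrow> fst (y s)) (at s within {s..u})"
      and g: "((\<lambda>r. snd (y r)) \<longlongrightarrow> snd (y s)) (at s within {s..u})"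
      by (auto intro: tendsto_intros)
    have "\<bar>fst (y s)\<bar> < R" "\<bar>snd (y s)\<bar> < R" by (simp_all add: R_def ys)
    then have "\<forall>\<^sub>F r in at s within {s..u}. \<bar>fst (y r)\<bar> < R"
      "\<forall>\<^sub>F r in at s within {s..u}. \<bar>snd (y r)\<bar> < R"
      using order_tendstoD(2)[OF tendsto_rabs[OF f]] order_tendstoD(2)[OF tendsto_rabs[OF g]] by auto
    moreover have "\<forall>\<^sub>F r in at s within {s..u}. fst (y s) > 0 \<longrightarrow> fst (y s) / 2 < fst (y r)"
      using order_tendstoD(1)[OF f, of "fst (y s) / 2"] by (cases "fst (y s) > 0") auto
    moreover have "\<forall>\<^sub>F r in at s within {s..u}. snd (y s) > 0 \<longrightarrow> snd (y s) / 2 < snd (y r)"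
      using order_tendstoD(1)[OF g, of "snd (y s) / 2"] by (cases "snd (y s) > 0") auto
    ultimately show ?thesis by eventually_elim auto
  qed
  from eventually_conj[OF this[OF z refl] this[OF w assms(3)[symmetric]]]
  obtain d where d: "d > 0" "\<And>r. r \<in> {s..u} \<Longrightarrow> r \<noteq> s \<Longrightarrow> dist r s < d \<Longrightarrow>
      (\<bar>fst (z r)\<bar> < R \<and> \<bar>snd (z r)\<bar> < R \<and> (fst (z s) > 0 \<longrightarrow> fst (z s) / 2 < fst (z r))
      \<and> (snd (z s) > 0 \<longrightarrow> snd (z s) / 2 < snd (z r))) \<and>
      (\<bar>fst (w r)\<bar> < R \<and> \<bar>snd (w r)\<bar> < R \<and> (fst (w s) > 0 \<longrightarrow> fst (w s) / 2 < fst (w r))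
      \<and> (snd (w s) > 0 \<longrightarrow> snd (w s) / 2 < snd (w r)))"
    unfolding eventually_at by blast
  define v where "v = min u (s + d / 2)"
  have sub: "{s..v} \<subseteq> {s..u}" by (auto simp: v_def)
  have near: "(\<bar>fst (z r)\<bar> < R \<and> \<bar>snd (z r)\<bar> < R \<and> (fst (z s) > 0 \<longrightarrow> fst (z s) / 2 < fst (z r))
      \<and> (snd (z s) > 0 \<longrightarrow> snd (z s) / 2 < snd (z r))) \<and>
      (\<bar>fst (w r)\<bar> < R \<and> \<bar>snd (w r)\<bar> < R \<and> (fst (w s) > 0 \<longrightarrow> fst (w s) / 2 < fst (w r))
      \<and> (snd (w s) > 0 \<longrightarrow> snd (w s) / 2 < snd (w r)))" if "r \<in> {s..v}" for r
  proof (cases "r = s")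
    case True
    then show ?thesis using assms(3) by (simp add: R_def add_pos_nonneg add_nonneg_pos)
  next
    case False
    then show ?thesis
      using d(2)[of r] that d(1) sub by (auto simp: v_def dist_real_def)
  qed
  have "z r = w r" if r: "r \<in> {s..v}" for r
  proof (cases "fst (z s) > 0")
    case True
    have "fst (z r) \<in> {fst (z s) / 2..R} \<and> \<bar>snd (z r)\<bar> \<le> R"
      "fst (w r) \<in> {fst (z s) / 2..R} \<and> \<bar>snd (w r)\<bar> \<le> R" if "r \<in> {s..v}" for r
      using near[OF that] True assms(3) by (simp_all add: abs_less_iff abs_le_iff less_imp_le)
    note bounds = this
    show ?thesis
      by (rule solves_eq_fst_pos[OF solves_subset[OF z sub] solves_subset[OF w sub],
            of "fst (z s) / 2" R R]) (use True r assms(3) bounds in auto)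
  next
    case False
    then have pos: "snd (z s) > 0" using assms(5) by simp
    have "snd (z r) \<in> {snd (z s) / 2..R} \<and> \<bar>fst (z r)\<bar> \<le> R"
      "snd (w r) \<in> {snd (z s) / 2..R} \<and> \<bar>fst (w r)\<bar> \<le> R" if "r \<in> {s..v}" for r
      using near[OF that] pos assms(3) by (simp_all add: abs_less_iff abs_le_iff less_imp_le)
    note bounds = this
    show ?thesis
      by (rule solves_eq_snd_pos[OF solves_subset[OF z sub] solves_subset[OF w sub],
            of "snd (z s) / 2" R R]) (use pos r assms(3) bounds in auto)
  qed
  then show ?thesis using d(1) by (intro exI[of _ "d / 2"]) (auto simp: v_def)
qed

lemma solves_unique_forward:
  assumes z: "solves a b \<gamma> z {s..u}" and w: "solves a b \<gamma> w {s..u}" and "z s = w s"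
    and "z s \<noteq> 0" and "t \<in> {s..u}"
  shows "z t = w t"
proof (rule continuous_induction[of "\<lambda>t. z t = w t" s u])
  fix t assume t: "s < t" "t \<le> u" and eq: "\<And>r. s \<le> r \<Longrightarrow> r < t \<Longrightarrow> z r = w r"
  have "(\<lambda>t. z t - w t) t = 0"
  proof (rule continuous_constant_on_closure[of "{s<..<t}" "\<lambda>t. z t - w t"])
    show "continuous_on (closure {s<..<t}) (\<lambda>t. z t - w t)"
      using t solves_continuous_on[OF z] solves_continuous_on[OF w]
      by (intro continuous_on_diff) (auto elim!: continuous_on_subset)
  qed (use t eq in auto)
  then show "z t = w t" by simp
next
  fix t assume t: "s \<le> t" "t < u" and eq: "\<And>r. s \<le> r \<Longrightarrow> r \<le> t \<Longrightarrow> z r = w r"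
  have sub: "{t..u} \<subseteq> {s..u}" using t by auto
  note zs = solves_subset[OF z sub] and ws = solves_subset[OF w sub]
  \<comment> \<open>A state other than the origin has a nonzero coordinate, which is positive after
    a reflection through the origin if necessary.\<close>
  have zt: "z t \<noteq> 0" by (rule solves_nonzero[OF z]) (use t assms in auto)
  have e: "z t = w t" using eq t by simp
  show "\<exists>e>0. \<forall>r. t \<le> r \<and> r < t + e \<and> r \<le> u \<longrightarrow> z r = w r"
  proof (cases "fst (z t) > 0 \<or> snd (z t) > 0")
    case True
    then show ?thesis by (intro solves_eq_locally[OF zs ws e t(2)])
  next
    case False
    then have "fst (- z t) > 0 \<or> snd (- z t) > 0" using zt by (auto simp: prod_eq_iff)
    then have "\<exists>e>0. \<forall>r. t \<le> r \<and> r < t + e \<and> r \<le> u \<longrightarrow> - z r = - w r"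
      using e by (intro solves_eq_locally[OF solves_minus[OF zs] solves_minus[OF ws] _ t(2)]) auto
    then show ?thesis by simp
  qed
qed (use assms in auto)

lemma is_path_unique:
  assumes z: "is_path a b \<gamma> z" and w: "is_path a b \<gamma> w" and eq: "z s = w s" and nz: "z s \<noteq> 0"
  shows "z = w"
proof
  fix t
  have z': "solves a b \<gamma> z S" and w': "solves a b \<gamma> w S" for S
    using z w solves_subset[of a b \<gamma> _ UNIV S] by (simp_all add: is_path_iff_solves)
  show "z t = w t"
  proof (cases "s \<le> t")
    case True
    then show ?thesis by (intro solves_unique_forward[OF z' w' eq nz, of t t]) auto
  next
    case False
    have "(fst (z (- (- t))), - snd (z (- (- t)))) = (fst (w (- (- t))), - snd (w (- (- t))))"
      using False eq nz
      by (intro solves_unique_forward[OF solves_reverse[OF z'] solves_reverse[OF w'], of "- s" "- t" "- t"])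
        (auto simp: prod_eq_iff)
    then show ?thesis by (simp add: prod_eq_iff)
  qed
qed

subsection \<open>Global existence\<close>

lemma continuous_on_energy: "continuous_on S (energy a b)"
  unfolding energy_def using a b
  by (intro continuous_on_add continuous_on_divide continuous_on_powr' continuous_on_rabs
      continuous_on_fst continuous_on_snd continuous_on_id continuous_on_const) auto

lemma continuous_on_damped_field: "continuous_on S (damped_field a b \<gamma>)"
  unfolding damped_field_eq using a b by (intro continuous_intros)

lemma compact_energy_sublevel: "compact {z. energy a b z \<le> r}"
proof -
  have "norm z \<le> (b * r) powr (1 / b) + (a * r) powr (1 / a)" if "energy a b z \<le> r" for z :: "real \<times> real"
  proof -
    have "(\<bar>fst z\<bar> powr b) powr (1 / b) \<le> (b * r) powr (1 / b)"
      using order_trans[OF abs_fst_powr_le_energy mult_left_mono[OF that, of b]] b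
      by (intro powr_mono2) auto
    moreover have "(\<bar>snd z\<bar> powr a) powr (1 / a) \<le> (a * r) powr (1 / a)"
      using order_trans[OF abs_snd_powr_le_energy mult_left_mono[OF that, of a]] a
      by (intro powr_mono2) auto
    ultimately have "\<bar>fst z\<bar> + \<bar>snd z\<bar> \<le> (b * r) powr (1 / b) + (a * r) powr (1 / a)"
      using a b by (simp add: powr_powr)
    moreover have "norm z \<le> \<bar>fst z\<bar> + \<bar>snd z\<bar>"
      using norm_Pair_le[of "fst z" "snd z"] by simp
    ultimately show ?thesis by linarith
  qed
  then have "bounded {z. energy a b z \<le> r}" by (auto simp: bounded_iff)
  moreover have "closed {z. energy a b z \<le> r}"
    by (intro closed_Collect_le continuous_on_energy continuous_on_const)
  ultimately show ?thesis by (simp add: compact_eq_bounded_closed)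
qed

text \<open>Multiplying the field by a cutoff function of the energy rescales time only, so the energy
  estimates survive and show that the cutoff is never active.\<close>

lemma solves_exists_compact:
  assumes "0 \<le> T"
  shows "\<exists>z. z 0 = z0 \<and> solves a b \<gamma> z {0..T}"
proof -
  define R where "R = energy a b z0 * exp (a * \<bar>\<gamma>\<bar> * T)"
  \<comment> \<open>The cutoff is 1 up to energy \<open>R\<close> and 0 from energy
    \<open>R + 1\<close> on, so \<open>F\<close> is bounded. \<open>R\<close> is the growth bound
    for friction of size at most \<bar>\<gamma>\<bar>, which also holds for the field with cutoff;
    hence energy \<open>R\<close> is never exceeded.\<close>
  define cut where "cut z = max 0 (min 1 (R + 1 - energy a b z))" for z
  have cut: "0 \<le> cut z" "cut z \<le> 1" for z by (auto simp: cut_def)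
  define F where "F z = cut z *\<^sub>R damped_field a b \<gamma> z" for z
  have "continuous_on UNIV F"
    unfolding F_def cut_def
    by (intro continuous_on_scaleR continuous_on_max continuous_on_min continuous_on_diff
        continuous_on_energy continuous_on_damped_field continuous_on_const)
  moreover obtain B where B: "\<And>z. energy a b z \<le> R + 1 \<Longrightarrow> norm (damped_field a b \<gamma> z) \<le> B"
    using compact_imp_bounded[OF compact_continuous_image[OF continuous_on_damped_field
          compact_energy_sublevel, of \<gamma> "R + 1"]]
    by (auto simp: bounded_iff)
  have "norm (F z) \<le> max B 0" for z
  proof (cases "energy a b z \<le> R + 1")
    case True
    then have "cut z * norm (damped_field a b \<gamma> z) \<le> 1 * norm (damped_field a b \<gamma> z)"
      using cut by (intro mult_right_mono) auto
    then show ?thesis using B[OF True] cut(1)[of z] by (simp add: F_def)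
  qed (simp add: F_def cut_def)
  ultimately obtain z where z: "z 0 = z0"
    "\<And>t. t \<in> {0..T} \<Longrightarrow> (z has_vector_derivative F (z t)) (at t within {0..T})"
    using peano[OF _ _ assms, of F "max B 0" z0] by blast
  have "cut (z t) = 1" if t: "t \<in> {0..T}" for t
  proof -
    have "energy a b (z t) \<le> energy a b (z 0) * exp (a * \<bar>\<gamma>\<bar> * (t - 0))"
    proof (rule energy_growth(1)[of "{0..T}" z "\<lambda>t. cut (z t) * \<gamma>"])
      fix t assume "t \<in> {0..T}"
      then show "((\<lambda>t. energy a b (z t)) has_real_derivative
          - (cut (z t) * \<gamma>) * \<bar>snd (z t)\<bar> powr a) (at t within {0..T})"
        using z(2) by (intro energy_has_derivative_scaled) (auto simp: F_def)
      show "\<bar>cut (z t) * \<gamma>\<bar> \<le> \<bar>\<gamma>\<bar>"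
        using cut by (simp add: abs_mult mult_left_le_one_le)
    qed (use t in auto)
    also have "\<dots> \<le> R"
      unfolding R_def z(1) using energy_nonneg a t by (intro mult_left_mono) (auto intro!: mult_left_mono)
    finally show ?thesis by (simp add: cut_def)
  qed
  then have "solves a b \<gamma> z {0..T}"
    using z(2) unfolding solves_def F_def by (metis scaleR_one)
  with z(1) show ?thesis by blast
qed

lemma solves_exists_forward:
  assumes "z0 \<noteq> 0"
  shows "\<exists>z. z 0 = z0 \<and> solves a b \<gamma> z {0..}"
proof -
  have "\<forall>n::nat. \<exists>z. z 0 = z0 \<and> solves a b \<gamma> z {0..real n}"
    using solves_exists_compact by simp
  then obtain u where u: "\<And>n::nat. u n 0 = z0" "\<And>n::nat. solves a b \<gamma> (u n) {0..real n}"
    by metis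
  \<comment> \<open>Uniqueness makes the solutions on different intervals agree where they
    overlap.\<close>
  define z where "z t = u (nat \<lceil>t\<rceil>) t" for t
  have z_eq: "z t = u n t" if "0 \<le> t" "t \<le> real n" for t n
  proof -
    have le: "t \<le> real (nat \<lceil>t\<rceil>)" by linarith
    show ?thesis
      unfolding z_def
      by (rule solves_unique_forward[OF solves_subset[OF u(2)[of "nat \<lceil>t\<rceil>"]]
            solves_subset[OF u(2)[of n]], of 0 t]) (use that le assms u(1) in auto)
  qed
  have "(z has_vector_derivative damped_field a b \<gamma> (z t)) (at t within {0..})" if t: "t \<ge> 0" for t
  proof -
    \<comment> \<open>The \<open>Suc\<close> puts \<open>t\<close> strictly below the right end,
      where the derivatives within \<open>{0..real n}\<close> and within \<open>{0..}\<close>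
      coincide.\<close>
    define n where "n = Suc (nat \<lceil>t\<rceil>)"
    have tn: "t < real n" unfolding n_def using real_nat_ceiling_ge[of t] by linarith
    have "(u n has_vector_derivative damped_field a b \<gamma> (u n t)) (at t within {0..real n})"
      using u(2)[of n] t tn by (simp add: solves_def)
    moreover have "at t within {0..real n} = at t within {0..}"
      by (rule at_within_nhd[of _ "{..<real n}"]) (use t tn in auto)
    ultimately have "(u n has_vector_derivative damped_field a b \<gamma> (z t)) (at t within {0..})"
      using z_eq[of t n] t tn by simp
    then show ?thesis
      by (rule has_vector_derivative_transform_within[where d = "real n - t"])
        (use t tn in \<open>auto simp: dist_real_def intro!: z_eq[symmetric]\<close>)
  qed
  then have "solves a b \<gamma> z {0..}" by (simp add: solves_def)
  moreover have "z 0 = z0" using z_eq[of 0 0] u(1) by simp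
  ultimately show ?thesis by blast
qed

text \<open>The past is the future of the time-reversed system. At time 0 both halves have the same
  value, hence the same one-sided derivative, and can be glued.\<close>

lemma is_path_exists:
  assumes "z0 \<noteq> 0"
  shows "\<exists>z. is_path a b \<gamma> z \<and> z s = z0"
proof -
  obtain f where f: "f 0 = z0" "solves a b \<gamma> f {0..}"
    using solves_exists_forward[OF assms] by blast
  have "(fst z0, - snd z0) \<noteq> 0" using assms by (auto simp: prod_eq_iff)
  then obtain g where g: "g 0 = (fst z0, - snd z0)" "solves a b (- \<gamma>) g {0..}"
    using solves_exists_forward by blast
  define h where "h t = (fst (g (- t)), - snd (g (- t)))" for t
  have "uminus ` {..0::real} = {0..}"
    by (auto simp: image_def intro!: exI[of _ "- _"]) (metis add.inverse_inverse neg_le_0_iff_le atMost_iff)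
  then have h: "solves a b \<gamma> h {..0}"
    using solves_reverse[of a b "- \<gamma>" g "{..0}"] g(2) by (simp add: h_def[abs_def])
  define z where "z t = (if t \<in> {0..} then f t else h t)" for t
  have h0: "h 0 = f 0" using f g by (simp add: h_def)
  have "(z has_vector_derivative damped_field a b \<gamma> (z t)) (at t)" for t
  proof -
    have eq: "{0..} \<union> {..<0::real} = UNIV" "closure {0..} \<inter> closure {..<0::real} = {0}"
      "{0..} \<union> {0} = {0::real..}" "{..<0} \<union> {0} = {..0::real}"
      by auto
    have "((\<lambda>t. if t \<in> {0..} then f t else h t) has_vector_derivative
        (if t \<in> {0..} then damped_field a b \<gamma> (f t) else damped_field a b \<gamma> (h t)))
        (at t within UNIV)"
    proof (rule has_vector_derivative_If_within_closures[of t "{0..}" "{..<0}"], unfold eq)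
      show "(f has_vector_derivative damped_field a b \<gamma> (f t)) (at t within {0..})" if "t \<in> {0..}"
        using f(2) that by (simp add: solves_def)
      show "(h has_vector_derivative damped_field a b \<gamma> (h t)) (at t within {..0})" if "t \<in> {..0}"
        using h that by (simp add: solves_def)
    qed (use h0 in auto)
    moreover have "(if t \<in> {0..} then damped_field a b \<gamma> (f t) else damped_field a b \<gamma> (h t))
        = damped_field a b \<gamma> (z t)"
      by (simp add: z_def)
    ultimately show ?thesis by (simp add: z_def[abs_def])
  qed
  then have "solves a b \<gamma> (\<lambda>t. z (t + - s)) UNIV"
    by (intro solves_shift) (simp add: solves_def)
  then show ?thesis
    using f(1) by (intro exI[of _ "\<lambda>t. z (t - s)"]) (simp add: is_path_iff_solves z_def)
qed

lemma rest_path_eqI: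
  assumes "is_path a b \<gamma> z" and "z 0 = (\<theta>, 0)" and "\<theta> \<noteq> 0"
  shows "rest_path a b \<gamma> \<theta> = z"
  unfolding rest_path_def
proof (rule the_equality)
  fix w assume "is_path a b \<gamma> w \<and> w 0 = (\<theta>, 0)"
  then show "w = z"
    using is_path_unique[OF _ assms(1), of w 0] assms by (simp add: zero_prod_def)
qed (use assms in simp)

lemma is_path_nonzero:
  assumes z: "is_path a b \<gamma> z" and "z s \<noteq> 0"
  shows "z t \<noteq> 0"
proof
  assume 0: "z t = 0"
  have *: "solves a b \<gamma> z S" for S
    using z solves_subset[of a b \<gamma> z UNIV S] by (simp add: is_path_iff_solves)
  show False
  proof (cases "s \<le> t")
    case True
    then show ?thesis using solves_nonzero[OF * assms(2), of t t] 0 by simp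
  next
    case False
    have "(\<lambda>t. (fst (z (- t)), - snd (z (- t)))) (- t) \<noteq> 0"
      by (rule solves_nonzero[OF solves_reverse[OF *], of "- s" "- t"])
        (use assms(2) False in \<open>auto simp: prod_eq_iff\<close>)
    then show ?thesis using 0 by (simp add: zero_prod_def)
  qed
qed

end

subsection \<open>Decay of the energy and slow paths\<close>

text \<open>Multiplying 1/a + 1/b < 1 by ab gives a + b < ab, which is \<open>superlinear\<close>;
  in this form it says that the exponent of the slow equation for x exceeds 1.\<close>

locale damped = exponents +
  fixes \<gamma> :: real
  assumes gamma: "\<gamma> > 0" and superlinear: "(a - 1) * (b - 1) > 1"
begin

lemma path_fst: "is_path a b \<gamma> z \<Longrightarrow> ((\<lambda>t. fst (z t)) has_real_derivative spow a (snd (z t))) (at t)"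
  using solves_fst[of a b \<gamma> z UNIV] by (simp add: is_path_iff_solves)

lemma path_snd: "is_path a b \<gamma> z \<Longrightarrow>
    ((\<lambda>t. snd (z t)) has_real_derivative - spow b (fst (z t)) - \<gamma> * snd (z t)) (at t)"
  using solves_snd[of a b \<gamma> z UNIV] by (simp add: is_path_iff_solves)

lemma path_minus: "is_path a b \<gamma> z \<Longrightarrow> is_path a b \<gamma> (\<lambda>t. - z t)"
  using solves_minus by (simp add: is_path_iff_solves)

lemma path_shift: "is_path a b \<gamma> z \<Longrightarrow> is_path a b \<gamma> (\<lambda>t. z (t + \<Delta>))"
  using solves_shift[of a b \<gamma> z \<Delta> UNIV] by (simp add: is_path_iff_solves surj_plus_right)

lemma path_continuous_on: "is_path a b \<gamma> z \<Longrightarrow> continuous_on S z"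
  using continuous_on_subset[OF solves_continuous_on[of a b \<gamma> z UNIV] subset_UNIV]
  by (simp add: is_path_iff_solves)

lemma path_energy_antimono:
  assumes "is_path a b \<gamma> z" "s \<le> t"
  shows "energy a b (z t) \<le> energy a b (z s)"
  by (rule nonincreasing_within[OF assms(2) subset_UNIV, where f' = "\<lambda>t. - \<gamma> * \<bar>snd (z t)\<bar> powr a"])
    (use energy_has_derivative[of \<gamma> z UNIV] assms(1) gamma in \<open>auto simp: is_path_iff_solves\<close>)

text \<open>Adding a small multiple of \<open>x p\<close> to the energy yields a function whose rate of decrease is
  bounded below away from the origin, also where \<open>p = 0\<close> and the energy itself is stationary.\<close>

lemma path_energy_small:
  assumes z: "is_path a b \<gamma> z" and e: "e > 0"
  shows "\<exists>t\<ge>0. energy a b (z t) < e"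
proof (rule ccontr)
  assume "\<not> ?thesis"
  then have large: "energy a b (z t) \<ge> e" if "t \<ge> 0" for t using that by force
  obtain X where X: "X > 0" "\<And>t. t \<ge> 0 \<Longrightarrow> norm (z t) \<le> X"
  proof -
    obtain X where X: "X > 0" "\<And>y. energy a b y \<le> energy a b (z 0) \<Longrightarrow> norm y \<le> X"
      using compact_imp_bounded[OF compact_energy_sublevel] unfolding bounded_pos by blast
    show ?thesis using that[of X] X path_energy_antimono[OF z] by blast
  qed
  have fX: "\<bar>fst (z t)\<bar> \<le> X" and sX: "\<bar>snd (z t)\<bar> \<le> X" if "t \<ge> 0" for t
    using X(2)[OF that] norm_fst_le[of "fst (z t)" "snd (z t)"] norm_snd_le[of "snd (z t)" "fst (z t)"]
    by auto
  \<comment> \<open>The derivative of x p is -|x|^b - \<gamma> x p + |p|^a. Of the middle term,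
    momenta up to \<open>d\<close> contribute at most \<open>e / 2\<close>; larger ones are absorbed
    by the decay of \<open>K\<close> times the energy.\<close>
  define d where "d = e / (2 * \<gamma> * X)"
  have d: "d > 0" "\<gamma> * X * d = e / 2" using e gamma X(1) by (auto simp: d_def)
  \<comment> \<open>One unit of the 2 cancels the term |p|^a above; the other leaves -|x|^b - |p|^a,
    which is at most minus the energy. Altogether \<open>G\<close> falls at rate at least
    \<open>e / 2\<close>.\<close>
  define K where "K = (2 + \<gamma> * X * d powr (1 - a)) / \<gamma>"
  have K: "K * \<gamma> = 2 + \<gamma> * X * d powr (1 - a)" "K \<ge> 0" using gamma X(1) by (auto simp: K_def)
  define G where "G t = fst (z t) * snd (z t) + K * energy a b (z t)" for t
  have G_le: "G t + e / 2 * t \<le> G 0 + e / 2 * 0" if "0 \<le> t" for t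
  proof (rule nonincreasing_within[OF that subset_UNIV])
    fix s assume "s \<in> {0..t}"
    then have s: "s \<ge> 0" by simp
    let ?x = "fst (z s)" and ?p = "snd (z s)"
    have E: "((\<lambda>t. energy a b (z t)) has_real_derivative - \<gamma> * \<bar>?p\<bar> powr a) (at s)"
      using energy_has_derivative[of \<gamma> z UNIV s] z by (simp add: is_path_iff_solves)
    show "((\<lambda>t. G t + e / 2 * t) has_real_derivative
        ?x * (- spow b ?x - \<gamma> * ?p) + spow a ?p * ?p + K * (- \<gamma> * \<bar>?p\<bar> powr a) + e / 2) (at s)"
      unfolding G_def
      by (rule derivative_eq_intros path_fst[OF z] path_snd[OF z] E refl)+ simp
    have p_le: "\<bar>?p\<bar> \<le> d + d powr (1 - a) * \<bar>?p\<bar> powr a"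
    proof (cases "\<bar>?p\<bar> \<le> d")
      case False
      then have "d powr (a - 1) \<le> \<bar>?p\<bar> powr (a - 1)" using d(1) a by (intro powr_mono2) auto
      then have "\<bar>?p\<bar> * (d powr (1 - a) * d powr (a - 1)) \<le> \<bar>?p\<bar> * (d powr (1 - a) * \<bar>?p\<bar> powr (a - 1))"
        by (intro mult_left_mono) auto
      also have "\<dots> = d powr (1 - a) * \<bar>?p\<bar> powr a"
        using powr_mult_base[of "\<bar>?p\<bar>" "a - 1"] by (simp add: mult_ac)
      also have "d powr (1 - a) * d powr (a - 1) = 1"
        using d(1) by (simp flip: powr_add)
      finally show ?thesis using d(1) by simp
    qed (simp add: add_increasing2)
    have "- (\<gamma> * (?x * ?p)) \<le> \<gamma> * X * \<bar>?p\<bar>"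
    proof -
      have "- (?x * ?p) \<le> \<bar>?x\<bar> * \<bar>?p\<bar>" using abs_ge_minus_self[of "?x * ?p"] by (simp add: abs_mult)
      also have "\<dots> \<le> X * \<bar>?p\<bar>" using fX[OF s] by (intro mult_right_mono) auto
      finally have "\<gamma> * - (?x * ?p) \<le> \<gamma> * (X * \<bar>?p\<bar>)" using gamma by (intro mult_left_mono) auto
      then show ?thesis by (simp add: mult.assoc)
    qed
    also have "\<dots> \<le> \<gamma> * X * (d + d powr (1 - a) * \<bar>?p\<bar> powr a)"
      using p_le gamma X(1) by (intro mult_left_mono) auto
    also have "\<dots> = e / 2 + (K * \<gamma> - 2) * \<bar>?p\<bar> powr a"
      using d(2) K(1) by (simp add: distrib_left mult_ac)
    finally have "- (\<gamma> * (?x * ?p)) \<le> e / 2 + (K * \<gamma> - 2) * \<bar>?p\<bar> powr a" .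
    moreover have "energy a b (z s) \<le> \<bar>?x\<bar> powr b + \<bar>?p\<bar> powr a"
      unfolding energy_def using a b
      by (intro add_mono) (auto simp: divide_le_eq mult_le_cancel_left1)
    ultimately have "- (\<gamma> * (?x * ?p)) - \<bar>?x\<bar> powr b + \<bar>?p\<bar> powr a - K * \<gamma> * \<bar>?p\<bar> powr a + e / 2 \<le> 0"
      using large[OF s] by (simp add: left_diff_distrib)
    then show "?x * (- spow b ?x - \<gamma> * ?p) + spow a ?p * ?p + K * (- \<gamma> * \<bar>?p\<bar> powr a) + e / 2 \<le> 0"
      using spow_mult_self[OF b, of ?x] spow_mult_self[OF a, of ?p] by (simp add: algebra_simps)
  qed
  have G_ge: "G t \<ge> - (X * X)" if "t \<ge> 0" for t
  proof -
    have "- (fst (z t) * snd (z t)) \<le> \<bar>fst (z t)\<bar> * \<bar>snd (z t)\<bar>"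
      using abs_ge_minus_self[of "fst (z t) * snd (z t)"] by (simp add: abs_mult)
    also have "\<dots> \<le> X * X" using fX[OF that] sX[OF that] by (intro mult_mono) auto
    finally show ?thesis
      unfolding G_def using mult_nonneg_nonneg[OF K(2) energy_nonneg[of "z t"]] by linarith
  qed
  define t where "t = (\<bar>G 0\<bar> + X * X + 1) * 2 / e"
  have t: "t \<ge> 0" using e by (simp add: t_def)
  have "e / 2 * t = \<bar>G 0\<bar> + X * X + 1" using e by (simp add: t_def)
  then show False using G_le[OF t] G_ge[OF t] by linarith
qed

lemma path_energy_tendsto_0:
  assumes z: "is_path a b \<gamma> z"
  shows "((\<lambda>t. energy a b (z t)) \<longlongrightarrow> 0) at_top"
proof (rule order_tendstoI)
  show "\<forall>\<^sub>F t in at_top. e < energy a b (z t)" if "e < 0" for e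
    using that energy_nonneg by (simp add: order_less_le_trans)
  show "\<forall>\<^sub>F t in at_top. energy a b (z t) < e" if e: "0 < e" for e
  proof -
    obtain s where "energy a b (z s) < e" using path_energy_small[OF z e] by blast
    then show ?thesis
      using path_energy_antimono[OF z] order.strict_trans1
      by (intro eventually_at_top_linorderI[of s]) blast
  qed
qed

lemma path_fst_tendsto_0: "is_path a b \<gamma> z \<Longrightarrow> ((\<lambda>t. fst (z t)) \<longlongrightarrow> 0) at_top"
  and path_snd_tendsto_0: "is_path a b \<gamma> z \<Longrightarrow> ((\<lambda>t. snd (z t)) \<longlongrightarrow> 0) at_top"
proof -
  assume z: "is_path a b \<gamma> z"
  have *: "(u \<longlongrightarrow> 0) at_top"
    if "c > 1" and le: "\<And>t. \<bar>u t\<bar> powr c \<le> c * energy a b (z t)" for u :: "real \<Rightarrow> real" and c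
  proof (rule Lim_null_comparison)
    have "((\<lambda>t. (c * energy a b (z t)) powr (1 / c)) \<longlongrightarrow> 0) at_top"
      using tendsto_mult_left[OF path_energy_tendsto_0[OF z], of c] that(1) energy_nonneg
      by (intro tendsto_zero_powrI[where b = "1 / c"]) auto
    then show "((\<lambda>t. (c * energy a b (z t)) powr (1 / c)) \<longlongrightarrow> 0) at_top" .
    have "norm (u t) \<le> (c * energy a b (z t)) powr (1 / c)" for t
    proof -
      have "(\<bar>u t\<bar> powr c) powr (1 / c) \<le> (c * energy a b (z t)) powr (1 / c)"
        using le that(1) by (intro powr_mono2) auto
      then show ?thesis using that(1) by (simp add: powr_powr)
    qed
    then show "\<forall>\<^sub>F t in at_top. norm (u t) \<le> (c * energy a b (z t)) powr (1 / c)" by simp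
  qed
  show "((\<lambda>t. fst (z t)) \<longlongrightarrow> 0) at_top"
    by (rule *[OF b abs_fst_powr_le_energy])
  show "((\<lambda>t. snd (z t)) \<longlongrightarrow> 0) at_top"
    by (rule *[OF a abs_snd_powr_le_energy])
qed

end

text \<open>A barrier test: positivity persists by continuity, and a zero with positive slope is
  left upwards. It is used on the boundary of the captured region.\<close>

lemma positive_on_right:
  fixes f :: "real \<Rightarrow> real"
  assumes f: "(f has_real_derivative l) (at t)" and "f t > 0 \<or> f t = 0 \<and> l > 0"
  shows "\<exists>d>0. \<forall>r. t < r \<and> r < t + d \<longrightarrow> f r > 0"
proof (cases "f t > 0")
  case True
  have "(f \<longlongrightarrow> f t) (at t)" using DERIV_isCont[OF f] by (simp add: isCont_def)
  from order_tendstoD(1)[OF this True] obtain d where "d > 0"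
    "\<And>r. r \<noteq> t \<Longrightarrow> dist r t < d \<Longrightarrow> f r > 0"
    unfolding eventually_at by auto
  then show ?thesis by (intro exI[of _ d]) (auto simp: dist_real_def)
next
  case False
  then obtain d where d: "d > 0" "\<And>h. 0 < h \<Longrightarrow> h < d \<Longrightarrow> f t < f (t + h)"
    using DERIV_pos_inc_right[OF f] assms(2) by blast
  then have "f r > 0" if "t < r" "r < t + d" for r
    using d(2)[of "r - t"] False assms(2) that by auto
  with d(1) show ?thesis by blast
qed

text \<open>An algebraic bound on the inverse is beaten by every decaying exponential; an
  exponential bound on \<open>x\<close> would then make that exponential negligible against itself.
  As \<open>inverse 0 = 0\<close>, the inverse bound alone would not exclude zeros of
  \<open>x\<close>, so their absence is carried along.\<close>

lemma slow_decay:
  fixes x :: "real \<Rightarrow> real"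
  assumes k: "k > 0" and x: "\<forall>\<^sub>F t in at_top. x t \<noteq> 0 \<and> \<bar>inverse (x t)\<bar> \<le> C * t powr k"
  shows "\<forall>\<^sub>F t in at_top. x t \<noteq> 0"
    and "(\<lambda>t. \<bar>inverse (x t)\<bar>) \<in> O(\<lambda>t. t powr k)"
    and "sublinearly_fast x" and "\<not> linearly_fast x"
proof -
  show nz: "\<forall>\<^sub>F t in at_top. x t \<noteq> 0" using x by (rule eventually_mono) simp
  show "(\<lambda>t. \<bar>inverse (x t)\<bar>) \<in> O(\<lambda>t. t powr k)"
    by (rule bigoI[of _ C]) (use x in \<open>auto elim: eventually_mono\<close>)
  have sub: "(\<lambda>t. exp (- c * t)) \<in> o(x)" if c: "c > 0" for c
  proof (rule smalloI_tendsto[OF _ nz])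
    show "((\<lambda>t. exp (- c * t) / x t) \<longlongrightarrow> 0) at_top"
    proof (rule Lim_null_comparison)
      show "\<forall>\<^sub>F t in at_top. norm (exp (- c * t) / x t) \<le> C * (t powr k * exp (- c * t))"
        using x
      proof eventually_elim
        case (elim t)
        then have "\<bar>inverse (x t)\<bar> * exp (- c * t) \<le> C * t powr k * exp (- c * t)"
          by (intro mult_right_mono) auto
        then show ?case by (simp add: divide_inverse abs_mult mult_ac)
      qed
      have "((\<lambda>t. t powr k * exp (- c * t)) \<longlongrightarrow> 0) at_top"
        using c by real_asymp
      then show "((\<lambda>t. C * (t powr k * exp (- c * t))) \<longlongrightarrow> 0) at_top"
        by (rule tendsto_mult_right_zero)
    qed
  qed
  then show "sublinearly_fast x" by (simp add: sublinearly_fast_def)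
  show "\<not> linearly_fast x"
  proof
    assume "linearly_fast x"
    then obtain c where c: "c > 0" "x \<in> O(\<lambda>t. exp (- c * t))" by (auto simp: linearly_fast_def)
    have "(\<lambda>t. exp (- c * t)) \<in> o(\<lambda>t. exp (- c * t))"
      using sub[OF c(1)] c(2) by (rule landau_o.small_big_trans)
    then have "\<forall>\<^sub>F t in at_top. exp (- c * t) = (0::real)"
      by (simp add: landau_o.small_refl_iff)
    then show False by simp
  qed
qed

section \<open>The captured region and the slow paths\<close>

context damped
begin

lemma rate_pos: "b * a - b - a > 0"
  using superlinear by (simp add: algebra_simps)

text \<open>The inequality is precisely what makes the field point inwards on the curve -p =
  (2/\<gamma>) x^(b-1).\<close>

definition small_radius :: "real \<Rightarrow> bool" where
  "small_radius r \<longleftrightarrow> r > 0 \<and>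
     (\<forall>x. 0 < x \<and> x \<le> r \<longrightarrow> (b - 1) * (2 / \<gamma>) powr a * x powr (b * a - b - a) < 1)"

lemma small_radius_exists: "\<exists>r. small_radius r"
proof -
  define c where "c = (b - 1) * (2 / \<gamma>) powr a"
  have c: "c > 0" using b gamma by (simp add: c_def)
  define r where "r = (1 / (2 * c)) powr (1 / (b * a - b - a))"
  have "c * x powr (b * a - b - a) < 1" if "0 < x" "x \<le> r" for x
  proof -
    have "x powr (b * a - b - a) \<le> r powr (b * a - b - a)"
      using that rate_pos by (intro powr_mono2) auto
    also have "\<dots> = 1 / (2 * c)"
      using rate_pos c by (simp add: r_def powr_powr)
    finally show ?thesis using c by (simp add: field_simps)
  qed
  moreover have "r > 0" using c by (simp add: r_def)
  ultimately have "small_radius r" by (simp add: small_radius_def c_def)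
  then show ?thesis ..
qed

text \<open>A one-sided neighbourhood of the slow manifold, on which \<open>p\<close> is approximately \<open>- x\<^sup>b\<^sup>-\<^sup>1 / \<gamma>\<close>.\<close>

definition captured :: "real \<Rightarrow> real \<times> real \<Rightarrow> bool" where
  "captured r z \<longleftrightarrow> 0 < fst z \<and> fst z \<le> r \<and> snd z \<le> 0 \<and> - snd z \<le> 2 / \<gamma> * fst z powr (b - 1)"

text \<open>The field points inwards on both curved sides, at p = 0 because of the force and at -p =
  (2/\<gamma>) x^(b-1) because of friction. The bound \<open>x \<le> r\<close> persists since x does
  not increase, and the corner at the origin is never reached.\<close>

lemma captured_forward:
  assumes r: "small_radius r" and z: "is_path a b \<gamma> z" and start: "captured r (z s)" and "s \<le> t"
  shows "captured r (z t)"
proof (rule continuous_induction[of "\<lambda>t. captured r (z t)" s t])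
  fix t assume t: "s < t" and before: "\<And>u. s \<le> u \<Longrightarrow> u < t \<Longrightarrow> captured r (z u)"
  \<comment> \<open>\<open>?C\<close> is the captured region with the origin added, which makes it
    closed; the origin is then excluded because the path does not vanish.\<close>
  let ?C = "{z. 0 \<le> fst z \<and> fst z \<le> r \<and> snd z \<le> 0 \<and> - snd z \<le> 2 / \<gamma> * \<bar>fst z\<bar> powr (b - 1)}
    :: (real \<times> real) set"
  have "closed ?C"
    using b by (intro closed_Collect_conj closed_Collect_le continuous_on_mult continuous_on_powr'
        continuous_on_rabs continuous_on_fst continuous_on_snd continuous_on_id continuous_on_const
        continuous_on_minus) auto
  moreover have "\<forall>\<^sub>F u in at_left t. z u \<in> ?C"
  proof (rule eventually_mono[OF eventually_at_left_real[OF t]])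
    show "z u \<in> ?C" if "u \<in> {s<..<t}" for u
      using before[of u] that by (auto simp: captured_def)
  qed
  moreover have "(z \<longlongrightarrow> z t) (at_left t)"
    using path_continuous_on[OF z, of UNIV] tendsto_within_subset[OF _ subset_UNIV]
    unfolding continuous_on_def by blast
  ultimately have zt: "z t \<in> ?C"
    using Lim_in_closed_set[OF _ _ trivial_limit_at_left_real] by blast
  have "fst (z s) \<noteq> 0" using start by (simp add: captured_def)
  then have "z t \<noteq> 0" using is_path_nonzero[OF z, of s t] by force
  moreover have "snd (z t) = 0" if "fst (z t) = 0" using zt that by simp
  ultimately have "0 < fst (z t)" using zt by (auto simp: prod_eq_iff less_le)
  then show "captured r (z t)" using zt by (simp add: captured_def)
next
  fix t assume "s \<le> t" and cap: "\<And>u. s \<le> u \<Longrightarrow> u \<le> t \<Longrightarrow> captured r (z u)"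
  let ?x = "fst (z t)" and ?p = "snd (z t)"
  have c: "0 < ?x" "?x \<le> r" "?p \<le> 0" "- ?p \<le> 2 / \<gamma> * ?x powr (b - 1)"
    using cap[of t] \<open>s \<le> t\<close> by (auto simp: captured_def)
  have "\<exists>d>0. \<forall>u. t < u \<and> u < t + d \<longrightarrow> fst (z u) > 0"
    using c by (intro positive_on_right[OF path_fst[OF z]]) auto
  moreover have "\<exists>d>0. \<forall>u. t < u \<and> u < t + d \<longrightarrow> - snd (z u) > 0"
    using c by (intro positive_on_right[OF DERIV_minus[OF path_snd[OF z]]]) (auto simp: spow_pos)
  moreover have "\<exists>d>0. \<forall>u. t < u \<and> u < t + d \<longrightarrow> 2 / \<gamma> * fst (z u) powr (b - 1) + snd (z u) > 0"
  proof (rule positive_on_right)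
    let ?l = "2 / \<gamma> * ((b - 1) * ?x powr (b - 2) * spow a ?p) + (- spow b ?x - \<gamma> * ?p)"
    show "((\<lambda>u. 2 / \<gamma> * fst (z u) powr (b - 1) + snd (z u)) has_real_derivative ?l) (at t)"
      by (rule derivative_eq_intros path_fst[OF z] path_snd[OF z] refl | use c(1) in simp)+
    \<comment> \<open>On this curve friction is twice the force, which leaves a surplus x^(b-1). The
      change of the curve itself as x falls is of higher order and smaller by the choice of
      \<open>r\<close>.\<close>
    have "?l > 0" if eq: "2 / \<gamma> * ?x powr (b - 1) + ?p = 0"
    proof -
      have p: "?p = - (2 / \<gamma> * ?x powr (b - 1))" using eq by simp
      have "2 / \<gamma> * ?x powr (b - 1) > 0" using gamma c(1) by simp
      then have "spow a ?p = - ((2 / \<gamma> * ?x powr (b - 1)) powr (a - 1))"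
        unfolding p by (subst spow_neg) auto
      also have "\<dots> = - ((2 / \<gamma>) powr (a - 1) * ?x powr ((b - 1) * (a - 1)))"
        using gamma c(1) by (subst powr_mult) (auto simp: powr_powr)
      finally have "2 / \<gamma> * ((b - 1) * ?x powr (b - 2) * spow a ?p)
          = - ((b - 1) * (2 / \<gamma> * (2 / \<gamma>) powr (a - 1)) * (?x powr (b - 2) * ?x powr ((b - 1) * (a - 1))))"
        by simp
      also have "2 / \<gamma> * (2 / \<gamma>) powr (a - 1) = (2 / \<gamma>) powr a"
        using powr_mult_base[of "2 / \<gamma>" "a - 1"] gamma by simp
      also have "?x powr (b - 2) * ?x powr ((b - 1) * (a - 1))
          = ?x powr (b - 1) * ?x powr (b * a - b - a)"
        by (simp add: algebra_simps flip: powr_add)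
      finally have "?l = ?x powr (b - 1) * (1 - (b - 1) * (2 / \<gamma>) powr a * ?x powr (b * a - b - a))"
        using p gamma c(1) by (simp add: spow_pos algebra_simps)
      moreover have "\<dots> > 0"
        using r c(1,2) by (intro mult_pos_pos) (auto simp: small_radius_def)
      ultimately show ?thesis by simp
    qed
    then show "2 / \<gamma> * ?x powr (b - 1) + ?p > 0 \<or> 2 / \<gamma> * ?x powr (b - 1) + ?p = 0 \<and> ?l > 0"
      using c(4) by linarith
  qed
  ultimately obtain d1 d2 d3 where d: "d1 > 0" "d2 > 0" "d3 > 0"
    "\<And>u. t < u \<Longrightarrow> u < t + d1 \<Longrightarrow> fst (z u) > 0"
    "\<And>u. t < u \<Longrightarrow> u < t + d2 \<Longrightarrow> - snd (z u) > 0"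
    "\<And>u. t < u \<Longrightarrow> u < t + d3 \<Longrightarrow> 2 / \<gamma> * fst (z u) powr (b - 1) + snd (z u) > 0"
    by blast
  define d where "d = min d1 (min d2 d3)"
  have d_le: "d \<le> d1" "d \<le> d2" "d \<le> d3" by (auto simp: d_def)
  have "captured r (z u)" if u: "t \<le> u" "u < t + d" for u
  proof (cases "u = t")
    case True
    then show ?thesis using cap[of t] \<open>s \<le> t\<close> by simp
  next
    case False
    have "fst (z u) \<le> ?x"
    proof (rule nonincreasing_within[OF u(1) subset_UNIV path_fst[OF z]])
      fix v assume v: "v \<in> {t..u}"
      show "spow a (snd (z v)) \<le> 0"
      proof (cases "v = t")
        case True
        then show ?thesis using c(3) by (simp add: spow_def mult_le_0_iff)
      next
        case False
        then have "snd (z v) < 0" using d(5)[of v] v u d_le by auto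
        then show ?thesis by (simp add: spow_neg)
      qed
    qed
    then show ?thesis
      using d(4-6)[of u] u False c(2) d_le by (simp add: captured_def)
  qed
  then show "\<exists>e>0. \<forall>u. t \<le> u \<and> u < t + e \<and> u \<le> t' \<longrightarrow> captured r (z u)" for t'
    using d(1-3) by (intro exI[of _ d]) (auto simp: d_def)
qed (use assms in auto)

text \<open>With \<open>k + 1 = (a - 1) * (b - 1)\<close> the bound on p gives a differential
  inequality for x under which x^(-k) grows at rate at most \<open>c\<close>, hence at most
  linearly; the claim is its \<open>k\<close>-th root.\<close>

lemma captured_slow:
  assumes z: "is_path a b \<gamma> z" and cap: "\<And>t. s \<le> t \<Longrightarrow> captured r (z t)"
  shows "\<exists>C. \<forall>\<^sub>F t in at_top. fst (z t) \<noteq> 0 \<and>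
    \<bar>inverse (fst (z t))\<bar> \<le> C * t powr (1 / (b * a - b - a))"
proof -
  define k where "k = b * a - b - a"
  have k: "k > 0" using rate_pos by (simp add: k_def)
  define c where "c = k * (2 / \<gamma>) powr (a - 1)"
  have c: "c > 0" using k gamma by (simp add: c_def)
  have lin: "fst (z t) powr (- k) - c * t \<le> fst (z s) powr (- k) - c * s" if "s \<le> t" for t
  proof (rule nonincreasing_within[OF that subset_UNIV])
    fix u assume "u \<in> {s..t}"
    then have u: "0 < fst (z u)" "snd (z u) \<le> 0" "- snd (z u) \<le> 2 / \<gamma> * fst (z u) powr (b - 1)"
      using cap[of u] by (auto simp: captured_def)
    show "((\<lambda>t. fst (z t) powr (- k) - c * t) has_real_derivative
        - k * fst (z u) powr (- k - 1) * spow a (snd (z u)) - c) (at u)"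
      by (rule derivative_eq_intros path_fst[OF z] refl | use u(1) in simp)+
    have "- spow a (snd (z u)) = (- snd (z u)) powr (a - 1)"
      using u(2) by (cases "snd (z u) = 0") (auto simp: spow_neg)
    also have "\<dots> \<le> (2 / \<gamma> * fst (z u) powr (b - 1)) powr (a - 1)"
      using u a by (intro powr_mono2) auto
    also have "\<dots> = (2 / \<gamma>) powr (a - 1) * fst (z u) powr ((b - 1) * (a - 1))"
      using gamma u(1) by (subst powr_mult) (auto simp: powr_powr)
    finally have "k * fst (z u) powr (- k - 1) * - spow a (snd (z u))
        \<le> k * fst (z u) powr (- k - 1) * ((2 / \<gamma>) powr (a - 1) * fst (z u) powr ((b - 1) * (a - 1)))"
      using k by (intro mult_left_mono) auto
    also have "\<dots> = c * (fst (z u) powr (- k - 1) * fst (z u) powr ((b - 1) * (a - 1)))"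
      by (simp add: c_def)
    also have "fst (z u) powr (- k - 1) * fst (z u) powr ((b - 1) * (a - 1)) = 1"
      using u(1) by (simp add: k_def algebra_simps flip: powr_add)
    finally show "- k * fst (z u) powr (- k - 1) * spow a (snd (z u)) - c \<le> 0" by simp
  qed
  define D where "D = \<bar>fst (z s) powr (- k) - c * s\<bar> + c"
  have D: "D > 0" using c by (simp add: D_def)
  have "fst (z t) \<noteq> 0 \<and> \<bar>inverse (fst (z t))\<bar> \<le> D powr (1 / k) * t powr (1 / k)"
    if t: "t \<ge> max 1 s" for t
  proof -
    have pos: "0 < fst (z t)" using cap[of t] t by (simp add: captured_def)
    have "fst (z t) powr (- k) \<le> \<bar>fst (z s) powr (- k) - c * s\<bar> * 1 + c * t"
      using lin[of t] t by simp
    also have "\<dots> \<le> \<bar>fst (z s) powr (- k) - c * s\<bar> * t + c * t"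
      using t by (intro add_right_mono mult_left_mono) auto
    also have "\<dots> = D * t" by (simp add: D_def algebra_simps)
    finally have "(fst (z t) powr (- k)) powr (1 / k) \<le> (D * t) powr (1 / k)"
      using k by (intro powr_mono2) auto
    moreover have "(fst (z t) powr (- k)) powr (1 / k) = inverse (fst (z t))"
      using pos k by (subst powr_powr) (simp add: powr_neg_one inverse_eq_divide)
    ultimately have "inverse (fst (z t)) \<le> D powr (1 / k) * t powr (1 / k)"
      using D t by (simp add: powr_mult)
    then show ?thesis using pos by simp
  qed
  then show ?thesis
    unfolding k_def by (intro exI eventually_at_top_linorderI[of "max 1 s"])
qed

text \<open>Once |x| < r, a zero of p lies in the captured region or its mirror image. So p finally
  keeps a sign, negative after reflection; then x strictly decreases towards 0 and must be
  positive.\<close>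

lemma not_captured_cases:
  assumes r: "small_radius r" and z: "is_path a b \<gamma> z" and nz: "z s \<noteq> 0"
    and nc: "\<And>t. \<not> captured r (z t) \<and> \<not> captured r (- z t)"
  obtains T w where "w = z \<or> w = (\<lambda>t. - z t)"
    and "\<And>t. t \<ge> T \<Longrightarrow> 0 < fst (w t) \<and> fst (w t) \<le> r \<and> snd (w t) < 0 \<and>
      2 / \<gamma> * fst (w t) powr (b - 1) < - snd (w t)"
proof -
  have r0: "r > 0" using r by (simp add: small_radius_def)
  have "\<forall>\<^sub>F t in at_top. \<bar>fst (z t)\<bar> < r"
    using order_tendstoD(2)[OF tendsto_rabs[OF path_fst_tendsto_0[OF z]], of r] r0 by simp
  then obtain T where T: "\<And>t. t \<ge> T \<Longrightarrow> \<bar>fst (z t)\<bar> < r"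
    by (auto simp: eventually_at_top_linorder)
  have p_nz: "snd (z t) \<noteq> 0" if t: "t \<ge> T" for t
  proof
    assume p: "snd (z t) = 0"
    then have "fst (z t) \<noteq> 0" using is_path_nonzero[OF z nz, of t] by (auto simp: prod_eq_iff)
    then have "captured r (z t) \<or> captured r (- z t)"
      using T[OF t] p gamma by (auto simp: captured_def)
    then show False using nc by blast
  qed
  define w where "w = (if snd (z T) < 0 then z else (\<lambda>t. - z t))"
  have w_cases: "w = z \<or> w = (\<lambda>t. - z t)" by (simp add: w_def)
  have w: "is_path a b \<gamma> w" using z path_minus by (simp add: w_def)
  have wT: "snd (w T) < 0" using p_nz[of T] by (auto simp: w_def)
  have w_nz: "snd (w t) \<noteq> 0" if "t \<ge> T" for t using p_nz[OF that] w_cases by auto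
  have w_small: "\<bar>fst (w t)\<bar> < r" if "t \<ge> T" for t using T[OF that] w_cases by auto
  have w_nc: "\<not> captured r (w t)" for t using nc[of t] w_cases by auto
  have neg: "snd (w t) < 0" if t: "t \<ge> T" for t
  proof (rule ccontr)
    assume "\<not> snd (w t) < 0"
    then have "\<exists>u\<ge>T. u \<le> t \<and> snd (w u) = 0"
      using wT t path_continuous_on[OF w]
      by (intro IVT'[of "\<lambda>t. snd (w t)" T 0 t]) (auto intro: continuous_intros)
    then show False using w_nz by blast
  qed
  have dec: "fst (w u) < fst (w t)" if "T \<le> t" "t < u" for t u
  proof (rule DERIV_neg_imp_decreasing[OF that(2)])
    fix v assume "t \<le> v"
    then have "snd (w v) < 0" using neg that by simp
    then show "\<exists>y. ((\<lambda>t. fst (w t)) has_real_derivative y) (at v) \<and> y < 0"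
      using path_fst[OF w, of v] by (intro exI[of _ "spow a (snd (w v))"]) (simp add: spow_neg)
  qed
  have pos: "0 < fst (w t)" if t: "t \<ge> T" for t
  proof -
    have "0 \<le> fst (w (t + 1))"
    proof (rule tendsto_upperbound[OF path_fst_tendsto_0[OF w]])
      show "\<forall>\<^sub>F u in at_top. fst (w u) \<le> fst (w (t + 1))"
        using dec[of "t + 1"] t
        by (intro eventually_at_top_linorderI[of "t + 1"]) (force simp: le_less)
    qed simp
    then show ?thesis using dec[of t "t + 1"] t by simp
  qed
  show thesis
  proof (rule that[OF w_cases])
    fix t assume t: "t \<ge> T"
    show "0 < fst (w t) \<and> fst (w t) \<le> r \<and> snd (w t) < 0 \<and>
      2 / \<gamma> * fst (w t) powr (b - 1) < - snd (w t)"
      using w_nc[of t] pos[OF t] w_small[OF t] neg[OF t] by (auto simp: captured_def)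
  qed
qed

subsection \<open>The fast path\<close>

text \<open>For v = |p|^(a-1) this is the quotient of the time derivatives of v and x along the
  flow, with |p| written as a power of v.\<close>

definition curve_slope :: "(real \<Rightarrow> real) \<Rightarrow> real \<Rightarrow> real" where
  "curve_slope v x = (a - 1) * (\<gamma> - x powr (b - 1) * v x powr (- (1 / (a - 1))))"

text \<open>The graph \<open>\<bar>p\<bar>\<^sup>a\<^sup>-\<^sup>1 = v(x)\<close> is invariant under the flow in the quadrant \<open>x > 0 > p\<close>.\<close>

definition fast_curve :: "real \<Rightarrow> real \<Rightarrow> (real \<Rightarrow> real) \<Rightarrow> bool" where
  "fast_curve r K v \<longleftrightarrow> r > 0 \<and> (\<forall>x\<in>{0..r}.
     (v has_real_derivative curve_slope v x) (at x within {0..r}) \<and>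
     (a - 1) * \<gamma> / 2 * x \<le> v x \<and> v x \<le> (a - 1) * \<gamma> * x \<and>
     (a - 1) * (\<gamma> - K * x powr (b - 1 - 1 / (a - 1))) * x \<le> v x)"

text \<open>For v proportional to x, the force-to-friction ratio x^(b-1) / |p| vanishes like x to
  this power, and the Lipschitz constant of the slope is of order x to this power minus 1, hence
  integrable.\<close>

lemma exponent_gap: "b - 1 - 1 / (a - 1) > 0"
  using superlinear a by (simp add: field_simps)

text \<open>The slope field is singular along \<open>v = 0\<close>; truncating it below the line of slope
  \<open>(a - 1) \<gamma> / 2\<close> makes it continuous, and the solution through the origin stays above that line.\<close>

lemma fast_curve_exists: "\<exists>r K v. fast_curve r K v"
proof -
  define B where "B = 1 / (a - 1)"
  define d where "d = b - 1 - B"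
  have B: "B > 0" and d: "d > 0" using a exponent_gap by (simp_all add: B_def d_def)
  define c where "c = (a - 1) * \<gamma> / 2"
  have c: "c > 0" using a gamma by (simp add: c_def)
  define K where "K = c powr (- B)"
  have K: "K > 0" using c by (simp add: K_def)
  \<comment> \<open>At this radius \<open>K * x powr d\<close> reaches half of \<gamma>, so the
    slope is at least \<open>c\<close> throughout \<open>{0..r}\<close>. The solution therefore
    stays above the line \<open>c * x\<close>, where the truncation is inactive.\<close>
  define r where "r = (\<gamma> / (2 * K)) powr (1 / d)"
  have r: "r > 0" using gamma K by (simp add: r_def)
  have Kr: "K * r powr d = \<gamma> / 2" using gamma K d by (simp add: r_def powr_powr)
  define clamp where "clamp s = max 0 (min s r)" for s :: real
  have clamp: "0 \<le> clamp s" "clamp s \<le> r" for s using r by (auto simp: clamp_def)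
  define h where "h y = clamp (fst y) powr (b - 1) * max (snd y) (c * clamp (fst y)) powr (- B)"
    for y :: "real \<times> real"
  have h_le: "h y \<le> K * clamp (fst y) powr d" for y
  proof (cases "clamp (fst y) = 0")
    case True
    then show ?thesis by (simp add: h_def)
  next
    case False
    then have pos: "clamp (fst y) > 0" using clamp(1)[of "fst y"] by simp
    then have "max (snd y) (c * clamp (fst y)) powr (- B) \<le> (c * clamp (fst y)) powr (- B)"
      using c B by (intro powr_mono2') auto
    also have "\<dots> = K * clamp (fst y) powr (- B)"
      using c pos by (simp add: K_def powr_mult)
    finally have "h y \<le> clamp (fst y) powr (b - 1) * (K * clamp (fst y) powr (- B))"
      unfolding h_def by (intro mult_left_mono) auto
    also have "\<dots> = K * (clamp (fst y) powr (b - 1) * clamp (fst y) powr (- B))" by simp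
    also have "\<dots> = K * clamp (fst y) powr d" by (simp add: d_def flip: powr_add)
    finally show ?thesis .
  qed
  have h_ge: "0 \<le> h y" for y by (simp add: h_def)
  have h_half: "h y \<le> \<gamma> / 2" for y
  proof -
    have "K * clamp (fst y) powr d \<le> K * r powr d"
      using K clamp d by (intro mult_left_mono powr_mono2) auto
    then show ?thesis using h_le[of y] Kr by simp
  qed
  have clamp_lim: "((\<lambda>y. clamp (fst y)) \<longlongrightarrow> clamp (fst y0)) (at y0)" for y0 :: "real \<times> real"
    unfolding clamp_def by (intro tendsto_intros)
  \<comment> \<open>Where the clamped abscissa is 0 the truncated power is not continuous by itself;
    there continuity of \<open>h\<close> comes from the bound \<open>h_le\<close>.\<close>
  have h_lim: "(h \<longlongrightarrow> h y0) (at y0)" for y0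
  proof (cases "clamp (fst y0) = 0")
    case True
    then have "((\<lambda>y. clamp (fst y)) \<longlongrightarrow> 0) (at y0)" using clamp_lim[of y0] by simp
    then have "((\<lambda>y. clamp (fst y) powr d) \<longlongrightarrow> 0) (at y0)"
      using d clamp(1) by (intro tendsto_zero_powrI[where b = d]) auto
    then have "((\<lambda>y. K * clamp (fst y) powr d) \<longlongrightarrow> 0) (at y0)" by (rule tendsto_mult_right_zero)
    then have "(h \<longlongrightarrow> 0) (at y0)"
      by (rule Lim_null_comparison[rotated]) (use h_le h_ge in auto)
    then show ?thesis using True by (simp add: h_def)
  next
    case False
    then have "clamp (fst y0) > 0" using clamp(1)[of "fst y0"] by simp
    then have "0 < max (snd y0) (c * clamp (fst y0))" using c by (simp add: less_max_iff_disj)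
    then show ?thesis
      unfolding h_def using False by (intro tendsto_intros clamp_lim) auto
  qed
  \<comment> \<open>The component 1 makes the abscissa agree with time, which turns the
    non-autonomous slope equation into an autonomous one.\<close>
  define F where "F y = (1::real, (a - 1) * (\<gamma> - h y))" for y
  have "continuous_on UNIV F"
    unfolding continuous_on_def F_def using h_lim by (auto intro!: tendsto_intros)
  moreover have "norm (F y) \<le> 1 + (a - 1) * \<gamma>" for y
  proof -
    have "\<bar>(a - 1) * (\<gamma> - h y)\<bar> \<le> (a - 1) * \<gamma>"
      using a gamma h_ge[of y] h_half[of y] by (simp add: abs_mult)
    then show ?thesis using norm_Pair_le[of "1::real" "(a - 1) * (\<gamma> - h y)"] by (simp add: F_def)
  qed
  ultimately obtain z where z: "z 0 = (0, 0)"
    "\<And>t. t \<in> {0..r} \<Longrightarrow> (z has_vector_derivative F (z t)) (at t within {0..r})"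
    using peano[of F _ r "(0, 0)"] r by (metis less_imp_le)
  define v where "v t = snd (z t)" for t
  have z1: "((\<lambda>t. fst (z t)) has_real_derivative 1) (at t within {0..r})" if "t \<in> {0..r}" for t
    using bounded_linear.has_vector_derivative[OF bounded_linear_fst z(2)[OF that]]
    by (simp add: has_real_derivative_iff_has_vector_derivative F_def)
  have v': "(v has_real_derivative (a - 1) * (\<gamma> - h (z t))) (at t within {0..r})" if "t \<in> {0..r}" for t
    using bounded_linear.has_vector_derivative[OF bounded_linear_snd z(2)[OF that]]
    by (simp add: has_real_derivative_iff_has_vector_derivative F_def v_def[abs_def])
  have fst_z: "fst (z t) = t" if t: "t \<in> {0..r}" for t
  proof -
    have *: "((\<lambda>t. fst (z t) - t) has_real_derivative 0) (at s within {0..r})" if "s \<in> {0..t}" for s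
      using z1[of s] that t by (auto intro!: derivative_eq_intros)
    have "fst (z 0) - 0 \<le> fst (z t) - t"
      by (rule nondecreasing_within[OF _ _ *]) (use t in auto)
    moreover have "fst (z t) - t \<le> fst (z 0) - 0"
      by (rule nonincreasing_within[OF _ _ *]) (use t in auto)
    ultimately show ?thesis using z(1) by simp
  qed
  have lower: "l * t \<le> v t"
    if t: "t \<in> {0..r}" and l: "\<And>s. s \<in> {0..t} \<Longrightarrow> l \<le> (a - 1) * (\<gamma> - h (z s))" for t l
  proof -
    have "v 0 - l * 0 \<le> v t - l * t"
    proof (rule nondecreasing_within[of 0 t "{0..r}"])
      fix s assume s: "s \<in> {0..t}"
      then show "((\<lambda>t. v t - l * t) has_real_derivative (a - 1) * (\<gamma> - h (z s)) - l) (at s within {0..r})"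
        using v'[of s] t by (auto intro!: derivative_eq_intros)
      show "0 \<le> (a - 1) * (\<gamma> - h (z s)) - l" using l[OF s] by simp
    qed (use t in auto)
    then show ?thesis using z(1) by (simp add: v_def)
  qed
  have upper: "v t \<le> (a - 1) * \<gamma> * t" if t: "t \<in> {0..r}" for t
  proof -
    have "v t - (a - 1) * \<gamma> * t \<le> v 0 - (a - 1) * \<gamma> * 0"
    proof (rule nonincreasing_within[of 0 t "{0..r}"])
      fix s assume s: "s \<in> {0..t}"
      then show "((\<lambda>t. v t - (a - 1) * \<gamma> * t) has_real_derivative
          (a - 1) * (\<gamma> - h (z s)) - (a - 1) * \<gamma>) (at s within {0..r})"
        using v'[of s] t by (auto intro!: derivative_eq_intros)
      show "(a - 1) * (\<gamma> - h (z s)) - (a - 1) * \<gamma> \<le> 0"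
        using mult_left_mono[of "\<gamma> - h (z s)" \<gamma> "a - 1"] h_ge[of "z s"] a by simp
    qed (use t in auto)
    then show ?thesis using z(1) by (simp add: v_def)
  qed
  have cv: "c * t \<le> v t" if t: "t \<in> {0..r}" for t
  proof (rule lower[OF t])
    fix s
    have "(a - 1) * (\<gamma> / 2) \<le> (a - 1) * (\<gamma> - h (z s))"
      using h_half[of "z s"] a by (intro mult_left_mono) auto
    then show "c \<le> (a - 1) * (\<gamma> - h (z s))" by (simp add: c_def)
  qed
  have h_eq: "h (z t) = t powr (b - 1) * v t powr (- B)" if t: "t \<in> {0..r}" for t
    using fst_z[OF t] cv[OF t] t by (simp add: h_def clamp_def v_def max_absorb1)
  have "fast_curve r K v"
    unfolding fast_curve_def
  proof (intro conjI ballI r)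
    fix x assume x: "x \<in> {0..r}"
    show "(v has_real_derivative curve_slope v x) (at x within {0..r})"
      using v'[OF x] by (simp add: h_eq[OF x] curve_slope_def B_def)
    show "(a - 1) * \<gamma> / 2 * x \<le> v x" using cv[OF x] by (simp add: c_def)
    show "v x \<le> (a - 1) * \<gamma> * x" by (rule upper[OF x])
    show "(a - 1) * (\<gamma> - K * x powr (b - 1 - 1 / (a - 1))) * x \<le> v x"
    proof (rule lower[OF x])
      fix s assume s: "s \<in> {0..x}"
      have "clamp (fst (z s)) = s" using fst_z[of s] s x by (simp add: clamp_def)
      then have "h (z s) \<le> K * s powr d" using h_le[of "z s"] by simp
      also have "\<dots> \<le> K * x powr d" using s K d by (intro mult_left_mono powr_mono2) auto
      finally have "(a - 1) * (\<gamma> - K * x powr d) \<le> (a - 1) * (\<gamma> - h (z s))"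
        using a by (intro mult_left_mono) auto
      then show "(a - 1) * (\<gamma> - K * x powr (b - 1 - 1 / (a - 1))) \<le> (a - 1) * (\<gamma> - h (z s))"
        by (simp add: d_def B_def)
    qed
  qed
  then show ?thesis by blast
qed

lemma fast_curve_pos: "fast_curve r K v \<Longrightarrow> 0 < x \<Longrightarrow> x \<le> r \<Longrightarrow> v x > 0"
proof -
  assume v: "fast_curve r K v" and x: "0 < x" "x \<le> r"
  have "0 < (a - 1) * \<gamma> / 2 * x" using a gamma x(1) by simp
  also have "\<dots> \<le> v x" using v x by (auto simp: fast_curve_def)
  finally show ?thesis .
qed

text \<open>In the coordinate \<open>y = ln x\<close> the motion \<open>x' = - v(x)\<close> on the curve has bounded speed.\<close>

lemma fast_curve_solution:
  assumes v: "fast_curve r K v" and T: "0 \<le> T"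
  shows "\<exists>x. x 0 = r \<and> (\<forall>t\<in>{0..T}. 0 < x t \<and> x t \<le> r) \<and>
    solves a b \<gamma> (\<lambda>t. (x t, - (v (x t) powr (1 / (a - 1))))) {0..T}"
proof -
  have r: "r > 0" using v by (simp add: fast_curve_def)
  have v_cont: "continuous_on {0..r} v"
    using v unfolding fast_curve_def by (meson DERIV_continuous_on)
  have v_nonneg: "v x \<ge> 0" if "x \<in> {0..r}" for x
  proof -
    have "0 \<le> (a - 1) * \<gamma> / 2 * x" using a gamma that by simp
    also have "\<dots> \<le> v x" using v that by (simp add: fast_curve_def)
    finally show ?thesis .
  qed
  \<comment> \<open>Cutting \<open>exp y\<close> off at \<open>r\<close> defines the speed for all
    \<open>y\<close>. The solution starts at \<open>ln r\<close> and does not increase, so the cut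
    stays inactive.\<close>
  define m where "m y = min (exp y) r" for y
  have m: "0 < m y" "m y \<le> r" for y using r by (auto simp: m_def)
  define F where "F y = - (v (m y) / m y)" for y
  have "continuous_on UNIV F"
    unfolding F_def
  proof (intro continuous_on_minus continuous_on_divide continuous_on_compose2[OF v_cont])
    show "continuous_on UNIV m" "continuous_on UNIV m"
      unfolding m_def[abs_def] by (intro continuous_intros)+
    show "range m \<subseteq> {0..r}" using m by (auto simp: less_imp_le)
    show "\<forall>x\<in>UNIV. m x \<noteq> 0" using m(1) by (auto simp: less_le)
  qed
  moreover have "norm (F y) \<le> (a - 1) * \<gamma>" for y
  proof -
    have "v (m y) \<le> (a - 1) * \<gamma> * m y" using v m[of y] by (auto simp: fast_curve_def)
    then show ?thesis using v_nonneg[of "m y"] m[of y] by (simp add: F_def field_simps)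
  qed
  ultimately obtain y where y: "y 0 = ln r"
    "\<And>t. t \<in> {0..T} \<Longrightarrow> (y has_vector_derivative F (y t)) (at t within {0..T})"
    using peano[of F _ T "ln r"] T by metis
  have y': "(y has_real_derivative F (y t)) (at t within {0..T})" if "t \<in> {0..T}" for t
    using y(2)[OF that] by (simp add: has_real_derivative_iff_has_vector_derivative)
  define x where "x t = exp (y t)" for t
  have x_pos: "0 < x t" for t by (simp add: x_def)
  have x_le: "x t \<le> r" if t: "t \<in> {0..T}" for t
  proof -
    have "y t \<le> y 0"
    proof (rule nonincreasing_within[of 0 t "{0..T}"])
      fix s assume "s \<in> {0..t}"
      then show "(y has_real_derivative F (y s)) (at s within {0..T})" using y' t by simp
      show "F (y s) \<le> 0" using v_nonneg[of "m (y s)"] m[of "y s"] by (simp add: F_def)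
    qed (use t in auto)
    then have "exp (y t) \<le> exp (ln r)" by (simp add: y(1))
    then show ?thesis using r by (simp add: x_def)
  qed
  have x': "(x has_real_derivative - v (x t)) (at t within {0..T})" if t: "t \<in> {0..T}" for t
  proof -
    have "m (y t) = x t" using x_le[OF t] by (simp add: m_def x_def)
    then have "x t * F (y t) = - v (x t)" using x_pos[of t] by (simp add: F_def)
    moreover have "(x has_real_derivative exp (y t) * F (y t)) (at t within {0..T})"
      unfolding x_def[abs_def] by (rule derivative_eq_intros y'[OF t] refl)+
    ultimately show ?thesis by (simp add: x_def)
  qed
  have "solves a b \<gamma> (\<lambda>t. (x t, - (v (x t) powr (1 / (a - 1))))) {0..T}"
  proof (rule solvesI)
    fix t assume t: "t \<in> {0..T}"
    have pos: "v (x t) > 0" using fast_curve_pos[OF v x_pos x_le[OF t]] .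
    have "spow a (- (v (x t) powr (1 / (a - 1)))) = - v (x t)"
      using pos a by (simp add: spow_pos powr_powr)
    then show "(x has_real_derivative spow a (- (v (x t) powr (1 / (a - 1))))) (at t within {0..T})"
      using x'[OF t] by simp
    have "(v has_real_derivative curve_slope v (x t)) (at (x t) within x ` {0..T})"
    proof (rule has_field_derivative_subset)
      show "(v has_real_derivative curve_slope v (x t)) (at (x t) within {0..r})"
        using v x_pos[of t] x_le[OF t] by (auto simp: fast_curve_def)
      show "x ` {0..T} \<subseteq> {0..r}" using x_le x_pos by (auto simp: less_imp_le)
    qed
    from DERIV_image_chain[OF this x'[OF t]]
    have vx: "((\<lambda>t. v (x t)) has_real_derivative curve_slope v (x t) * - v (x t)) (at t within {0..T})"
      by (simp add: o_def)
    let ?B = "1 / (a - 1)"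
    have "((\<lambda>t. - (v (x t) powr ?B)) has_real_derivative
        - (?B * v (x t) powr (?B - 1) * (curve_slope v (x t) * - v (x t)))) (at t within {0..T})"
      by (rule derivative_eq_intros vx refl | use pos in simp)+
    moreover have "- (?B * v (x t) powr (?B - 1) * (curve_slope v (x t) * - v (x t)))
        = - spow b (x t) - \<gamma> * - (v (x t) powr ?B)"
    proof -
      have assoc: "- (B * p * ((a - 1) * s * - y)) = (B * (a - 1)) * (y * p) * s" for B p s y :: real
        by (simp add: algebra_simps)
      have "- (?B * v (x t) powr (?B - 1) * (curve_slope v (x t) * - v (x t)))
          = (?B * (a - 1)) * (v (x t) * v (x t) powr (?B - 1))
            * (\<gamma> - x t powr (b - 1) * v (x t) powr (- ?B))"
        unfolding curve_slope_def by (rule assoc)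
      also have "\<dots> = v (x t) powr ?B * (\<gamma> - x t powr (b - 1) * v (x t) powr (- ?B))"
        using pos a by (simp add: powr_mult_base)
      also have "\<dots> = \<gamma> * v (x t) powr ?B - x t powr (b - 1) * (v (x t) powr ?B * v (x t) powr (- ?B))"
        by (simp add: algebra_simps)
      also have "v (x t) powr ?B * v (x t) powr (- ?B) = 1"
        using pos by (simp flip: powr_add)
      finally show ?thesis using x_pos[of t] by (simp add: spow_pos)
    qed
    ultimately show "((\<lambda>t. - (v (x t) powr ?B)) has_real_derivative
        - spow b (x t) - \<gamma> * - (v (x t) powr ?B)) (at t within {0..T})"
      by simp
  qed
  moreover have "x 0 = r" using y(1) r by (simp add: x_def)
  ultimately show ?thesis using x_pos x_le by blast
qed

definition on_curve :: "real \<Rightarrow> (real \<Rightarrow> real) \<Rightarrow> real \<times> real \<Rightarrow> bool" where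
  "on_curve r v z \<longleftrightarrow> 0 < fst z \<and> fst z \<le> r \<and> snd z = - (v (fst z) powr (1 / (a - 1)))"

text \<open>The path through the right end of the curve agrees, by uniqueness, on every
  \<open>{0..t}\<close> with the motion constructed on the curve, so it never leaves the
  curve.\<close>

lemma fast_path_exists:
  assumes v: "fast_curve r K v"
  obtains w where "is_path a b \<gamma> w" and "fst (w 0) = r" and "\<And>t. t \<ge> 0 \<Longrightarrow> on_curve r v (w t)"
proof -
  have r: "r > 0" using v by (simp add: fast_curve_def)
  define z0 where "z0 = (r, - (v r powr (1 / (a - 1))))"
  have z0: "z0 \<noteq> 0" using r by (simp add: z0_def zero_prod_def)
  then obtain w where w: "is_path a b \<gamma> w" "w 0 = z0" using is_path_exists by blast
  have "on_curve r v (w t)" if t: "t \<ge> 0" for t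
  proof -
    obtain x where x: "x 0 = r" "\<forall>t\<in>{0..t}. 0 < x t \<and> x t \<le> r"
      "solves a b \<gamma> (\<lambda>t. (x t, - (v (x t) powr (1 / (a - 1))))) {0..t}"
      using fast_curve_solution[OF v t] by blast
    have "w t = (x t, - (v (x t) powr (1 / (a - 1))))"
      by (rule solves_unique_forward[OF solves_subset[OF w(1)[unfolded is_path_iff_solves] subset_UNIV]
            x(3)]) (use w(2) z0 x(1) t in \<open>auto simp: z0_def\<close>)
    then show ?thesis using x(2) t by (simp add: on_curve_def)
  qed
  with w show thesis by (intro that[of w]) (auto simp: z0_def)
qed

lemma on_curve_spow:
  assumes "fast_curve r K v" "on_curve r v z"
  shows "spow a (snd z) = - v (fst z)"
proof -
  have "v (fst z) > 0" using fast_curve_pos[OF assms(1)] assms(2) by (simp add: on_curve_def)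
  then show ?thesis
    using assms(2) a by (simp add: on_curve_def spow_pos powr_powr)
qed

text \<open>The sharper lower bound on \<open>v\<close> shows that the relative speed of x tends to
  at least (a - 1) \<gamma> as x tends to 0, so it finally exceeds \<alpha>.\<close>

lemma fast_path_rate:
  assumes v: "fast_curve r K v" and w: "is_path a b \<gamma> w"
    and on: "\<And>t. t \<ge> 0 \<Longrightarrow> on_curve r v (w t)" and \<alpha>: "\<alpha> < \<gamma> * (a - 1)"
  shows "(\<lambda>t. fst (w t)) \<in> O(\<lambda>t. exp (- \<alpha> * t))"
proof -
  define d where "d = b - 1 - 1 / (a - 1)"
  have "d > 0" using exponent_gap by (simp add: d_def)
  have "((\<lambda>t. fst (w t) powr d) \<longlongrightarrow> 0) at_top"
  proof (rule tendsto_zero_powrI[where b = d])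
    show "\<forall>\<^sub>F t in at_top. 0 \<le> fst (w t)"
      using on by (intro eventually_at_top_linorderI[of 0]) (auto simp: on_curve_def intro: less_imp_le)
  qed (use path_fst_tendsto_0[OF w] \<open>d > 0\<close> in auto)
  then have "((\<lambda>t. (a - 1) * (\<gamma> - K * fst (w t) powr d)) \<longlongrightarrow> (a - 1) * (\<gamma> - K * 0)) at_top"
    by (intro tendsto_intros)
  moreover have "(a - 1) * (\<gamma> - K * 0) > \<alpha>" using \<alpha> by (simp add: mult.commute)
  ultimately have "\<forall>\<^sub>F t in at_top. (a - 1) * (\<gamma> - K * fst (w t) powr d) > \<alpha>"
    by (rule order_tendstoD(1))
  then obtain T where T: "\<And>t. t \<ge> T \<Longrightarrow> (a - 1) * (\<gamma> - K * fst (w t) powr d) > \<alpha>"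
    by (auto simp: eventually_at_top_linorder)
  define s where "s = max 0 T"
  have "fst (w t) * exp (\<alpha> * t) \<le> fst (w s) * exp (\<alpha> * s)" if "s \<le> t" for t
  proof (rule nonincreasing_within[OF that subset_UNIV])
    fix u assume "u \<in> {s..t}"
    then have u: "u \<ge> 0" "u \<ge> T" by (auto simp: s_def)
    have pos: "0 < fst (w u)" "fst (w u) \<le> r" using on[OF u(1)] by (auto simp: on_curve_def)
    show "((\<lambda>t. fst (w t) * exp (\<alpha> * t)) has_real_derivative
        (spow a (snd (w u)) + \<alpha> * fst (w u)) * exp (\<alpha> * u)) (at u)"
      by (rule derivative_eq_intros path_fst[OF w] refl)+ (simp add: algebra_simps)
    have "\<alpha> * fst (w u) \<le> (a - 1) * (\<gamma> - K * fst (w u) powr d) * fst (w u)"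
      using T[OF u(2)] pos by (intro mult_right_mono) auto
    also have "\<dots> \<le> v (fst (w u))" using v pos by (auto simp: fast_curve_def d_def)
    finally show "(spow a (snd (w u)) + \<alpha> * fst (w u)) * exp (\<alpha> * u) \<le> 0"
      using on_curve_spow[OF v on[OF u(1)]] by (simp add: mult_le_0_iff)
  qed
  note decay = this
  show ?thesis
  proof (rule bigoI)
    show "\<forall>\<^sub>F t in at_top. norm (fst (w t)) \<le> (fst (w s) * exp (\<alpha> * s)) * norm (exp (- \<alpha> * t))"
    proof (rule eventually_at_top_linorderI[of s])
      fix t assume t: "s \<le> t"
      have "fst (w t) = fst (w t) * exp (\<alpha> * t) * exp (- \<alpha> * t)"
        by (simp add: mult.assoc flip: exp_add)
      also have "\<dots> \<le> fst (w s) * exp (\<alpha> * s) * exp (- \<alpha> * t)"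
        using decay[OF t] by (intro mult_right_mono) auto
      finally show "norm (fst (w t)) \<le> (fst (w s) * exp (\<alpha> * s)) * norm (exp (- \<alpha> * t))"
        using on[of t] t by (auto simp: on_curve_def s_def)
    qed
  qed
qed

end

section \<open>Uniqueness of the fast curve\<close>

lemma powr_neg_lipschitz:
  fixes e l x y :: real
  assumes "e > 0" "l > 0" "l \<le> x" "l \<le> y"
  shows "\<bar>x powr (- e) - y powr (- e)\<bar> \<le> e * l powr (- e - 1) * \<bar>x - y\<bar>"
proof -
  have "norm (x powr (- e) - y powr (- e)) \<le> (e * l powr (- e - 1)) * norm (x - y)"
  proof (rule field_differentiable_bound[of "{l..}"])
    fix u assume u: "u \<in> {l..}"
    then show "((\<lambda>u. u powr (- e)) has_real_derivative - e * u powr (- e - 1)) (at u within {l..})"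
      using assms by (auto intro!: derivative_eq_intros)
    show "norm (- e * u powr (- e - 1)) \<le> e * l powr (- e - 1)"
      using u assms by (auto simp: abs_mult intro!: mult_left_mono powr_mono2')
  qed (use assms in auto)
  then show ?thesis by simp
qed

context damped
begin

text \<open>Dividing out the contraction rate of the difference of two curves, which is integrable
  because \<open>(a - 1) (b - 1) > 1\<close>, the squared difference is nondecreasing in time; as it tends to
  \<open>0\<close>, it vanishes.\<close>

lemma eventually_on_curve:
  assumes v: "fast_curve r K v" and w: "is_path a b \<gamma> w"
    and fast: "\<And>t. t \<ge> T \<Longrightarrow> 0 < fst (w t) \<and> fst (w t) \<le> r \<and> snd (w t) < 0 \<and>
      2 / \<gamma> * fst (w t) powr (b - 1) < - snd (w t)"
    and t: "t \<ge> T"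
  shows "on_curve r v (w t)"
proof -
  define B where "B = 1 / (a - 1)"
  define d where "d = b - 1 - B"
  define c where "c = (a - 1) * \<gamma> / 2"
  have B: "B > 0" "(a - 1) * B = 1" and d: "d > 0" and c: "c > 0"
    using a gamma exponent_gap by (simp_all add: B_def d_def c_def)
  define x where "x t = fst (w t)" for t
  define q where "q t = - snd (w t)" for t
  define U where "U t = q t powr (a - 1)" for t
  define V where "V t = v (x t)" for t
  have xq: "0 < x t" "x t \<le> r" "0 < q t" "x t powr (b - 1) \<le> \<gamma> / 2 * q t" if "t \<ge> T" for t
    using fast[OF that] gamma by (simp_all add: x_def q_def field_simps)
  have U_pos: "U t > 0" if "t \<ge> T" for t using xq[OF that] by (simp add: U_def)
  have UB: "U t powr B = q t" if "t \<ge> T" for t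
    using xq[OF that] B by (simp add: U_def powr_powr)
  have x_lim: "(x \<longlongrightarrow> 0) at_top" unfolding x_def[abs_def] by (rule path_fst_tendsto_0[OF w])
  have q_lim: "(q \<longlongrightarrow> 0) at_top"
    unfolding q_def[abs_def] using tendsto_minus[OF path_snd_tendsto_0[OF w]] by simp
  have U_lim: "(U \<longlongrightarrow> 0) at_top"
    unfolding U_def[abs_def]
  proof (rule tendsto_zero_powrI[OF q_lim tendsto_const])
    show "\<forall>\<^sub>F t in at_top. 0 \<le> q t"
      by (rule eventually_at_top_linorderI[of T]) (use xq in \<open>auto intro: less_imp_le\<close>)
  qed (use a in auto)
  have V_pos: "V t > 0" if "t \<ge> T" for t
    unfolding V_def using fast_curve_pos[OF v] xq[OF that] by simp
  have V_bounds: "c * x t \<le> V t" "V t \<le> (a - 1) * \<gamma> * x t" if "t \<ge> T" for t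
    using v xq[OF that] by (auto simp: fast_curve_def V_def c_def)
  have V_lim: "(V \<longlongrightarrow> 0) at_top"
  proof (rule Lim_null_comparison)
    show "\<forall>\<^sub>F t in at_top. norm (V t) \<le> (a - 1) * \<gamma> * x t"
      by (rule eventually_at_top_linorderI[of T]) (use V_bounds V_pos in \<open>auto simp: less_imp_le\<close>)
    show "((\<lambda>t. (a - 1) * \<gamma> * x t) \<longlongrightarrow> 0) at_top" using x_lim by (rule tendsto_mult_right_zero)
  qed
  have x': "(x has_real_derivative - U t) (at t within {T..})" if "t \<ge> T" for t
    using has_field_derivative_at_within[OF path_fst[OF w, of t]] fast[OF that]
    by (simp add: x_def[abs_def] U_def q_def spow_neg)
  have q': "(q has_real_derivative x t powr (b - 1) - \<gamma> * q t) (at t within {T..})" if "t \<ge> T" for t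
    using has_field_derivative_at_within[OF DERIV_minus[OF path_snd[OF w, of t]]] fast[OF that]
    by (simp add: x_def q_def[abs_def] spow_pos add.commute)
  have U': "(U has_real_derivative (a - 1) * U t * (x t powr (b - 1) * U t powr (- B) - \<gamma>))
      (at t within {T..})" if "t \<ge> T" for t
  proof -
    have "(U has_real_derivative (a - 1) * q t powr (a - 2) * (x t powr (b - 1) - \<gamma> * q t))
        (at t within {T..})"
      unfolding U_def[abs_def]
      by (rule derivative_eq_intros q'[OF that] refl | use xq[OF that] in simp)+
    moreover have "(a - 1) * U t * (x t powr (b - 1) * U t powr (- B) - \<gamma>)
        = (a - 1) * q t powr (a - 2) * (x t powr (b - 1) - \<gamma> * q t)"
    proof -
      have inv: "U t powr (- B) = 1 / q t"
        using UB[OF that] by (simp add: powr_minus inverse_eq_divide)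
      have split: "U t = q t * q t powr (a - 2)"
        using powr_mult_base[of "q t" "a - 2"] xq[OF that] by (simp add: U_def)
      show ?thesis
        unfolding inv by (subst split) (use xq(3)[OF that] in \<open>simp add: field_simps\<close>)
    qed
    ultimately show ?thesis by (simp only:)
  qed
  have V': "(V has_real_derivative curve_slope v (x t) * - U t) (at t within {T..})"
    if "t \<ge> T" for t
  proof -
    have "(v has_real_derivative curve_slope v (x t)) (at (x t) within x ` {T..})"
    proof (rule has_field_derivative_subset)
      show "(v has_real_derivative curve_slope v (x t)) (at (x t) within {0..r})"
        using v xq[OF that] by (auto simp: fast_curve_def)
      show "x ` {T..} \<subseteq> {0..r}" using xq by (auto simp: less_imp_le)
    qed
    from DERIV_image_chain[OF this x'[OF that]] show ?thesis
      by (simp add: o_def V_def[abs_def])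
  qed
  \<comment> \<open>Outside the captured region x^(b-1) / |p| is at most \<gamma>/2, so
    \<open>U - c * x\<close> is nonincreasing in time; since it tends to 0, it is
    nonnegative.\<close>
  have U_ge: "c * x t \<le> U t" if t: "t \<ge> T" for t
  proof -
    have "U s - c * x s \<le> U t - c * x t" if "t \<le> s" for s
    proof (rule nonincreasing_within[OF that])
      fix u assume "u \<in> {t..s}"
      then have u: "u \<ge> T" using t by simp
      show "((\<lambda>t. U t - c * x t) has_real_derivative
          (a - 1) * U u * (x u powr (b - 1) * U u powr (- B) - \<gamma>) - c * - U u) (at u within {T..})"
        by (rule derivative_eq_intros U'[OF u] x'[OF u] refl)+ simp
      have "x u powr (b - 1) * U u powr (- B) \<le> \<gamma> / 2 * q u * (1 / q u)"
        using xq[OF u] UB[OF u] gamma by (intro mult_mono) (auto simp: powr_minus inverse_eq_divide)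
      then have "x u powr (b - 1) * U u powr (- B) - \<gamma> \<le> - (\<gamma> / 2)" using xq[OF u] by simp
      then have "(a - 1) * U u * (x u powr (b - 1) * U u powr (- B) - \<gamma>) \<le> (a - 1) * U u * - (\<gamma> / 2)"
        using a U_pos[OF u] by (intro mult_left_mono) auto
      also have "(a - 1) * U u * - (\<gamma> / 2) = c * - U u" by (simp add: c_def)
      finally show "(a - 1) * U u * (x u powr (b - 1) * U u powr (- B) - \<gamma>) - c * - U u \<le> 0"
        by (simp only: diff_le_0_iff_le)
    qed (use t in auto)
    then have "\<forall>\<^sub>F s in at_top. U s - c * x s \<le> U t - c * x t"
      by (rule eventually_at_top_linorderI)
    moreover have "((\<lambda>s. U s - c * x s) \<longlongrightarrow> 0 - c * 0) at_top"
      by (intro tendsto_intros U_lim x_lim)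
    ultimately have "0 - c * 0 \<le> U t - c * x t"
      by (intro tendsto_upperbound[of "\<lambda>s. U s - c * x s" _ at_top]) auto
    then show ?thesis by simp
  qed
  \<comment> \<open>Twice the constant of the Lipschitz bound for U^(-B) above the line
    \<open>c * x\<close>, the factor \<open>(a - 1) * B\<close> being 1.\<close>
  define N where "N = 2 * c powr (- B - 1)"
  have N: "N > 0" using c by (simp add: N_def)
  \<comment> \<open>The exponent is an antiderivative in x of the rate
    \<open>N * x powr (d - 1)\<close>. It stays finite at \<open>x = 0\<close> because
    \<open>d > 0\<close>.\<close>
  define Q where "Q t = (U t - V t)\<^sup>2 * exp (- (N / d * x t powr d))" for t
  have Q_mono: "Q s \<le> Q u" if "T \<le> s" "s \<le> u" for s u
  proof (rule nondecreasing_within[OF that(2)])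
    fix t assume "t \<in> {s..u}"
    then have t: "t \<ge> T" using that by simp
    define D where "D = U t - V t"
    define D' where "D' = (a - 1) * U t * (x t powr (b - 1) * U t powr (- B) - \<gamma>) - curve_slope v (x t) * - U t"
    show "(Q has_real_derivative
        (2 * D * D' + N * x t powr (d - 1) * U t * D\<^sup>2) * exp (- (N / d * x t powr d))) (at t within {T..})"
    proof -
      have p: "((\<lambda>t. x t powr d) has_real_derivative d * x t powr (d - 1) * - U t) (at t within {T..})"
        by (rule derivative_eq_intros x'[OF t] refl | use xq[OF t] in simp)+
      show ?thesis
        unfolding Q_def[abs_def]
        by (rule derivative_eq_intros U'[OF t] V'[OF t] p refl)+
          (use d in \<open>simp add: D_def D'_def power2_eq_square algebra_simps\<close>)
    qed
    \<comment> \<open>Both functions are differentiated along the same motion x' = -U, so the terms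
      with \<gamma> cancel and only the singular ones remain.\<close>
    have D'_eq: "D' = ((a - 1) * U t * x t powr (b - 1)) * (U t powr (- B) - V t powr (- B))"
      by (simp add: D'_def curve_slope_def V_def B_def algebra_simps)
    have "\<bar>U t powr (- B) - V t powr (- B)\<bar> \<le> B * (c * x t) powr (- B - 1) * \<bar>U t - V t\<bar>"
      using B c xq[OF t] U_ge[OF t] V_bounds[OF t] by (intro powr_neg_lipschitz) auto
    then have "\<bar>D'\<bar> \<le> ((a - 1) * U t * x t powr (b - 1)) * (B * (c * x t) powr (- B - 1) * \<bar>D\<bar>)"
      unfolding D'_eq abs_mult D_def using a U_pos[OF t]
      by (intro mult_mono) (auto simp: abs_mult)
    also have "\<dots> = ((a - 1) * B) * c powr (- B - 1) * (x t powr (b - 1) * x t powr (- B - 1)) * U t * \<bar>D\<bar>"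
      using c xq[OF t] by (simp add: powr_mult)
    also have "\<dots> = N / 2 * x t powr (d - 1) * U t * \<bar>D\<bar>"
      by (simp add: B(2) N_def d_def flip: powr_add)
    finally have "\<bar>D\<bar> * \<bar>D'\<bar> \<le> \<bar>D\<bar> * (N / 2 * x t powr (d - 1) * U t * \<bar>D\<bar>)"
      by (intro mult_left_mono) auto
    also have "\<dots> = N / 2 * x t powr (d - 1) * U t * D\<^sup>2"
      by (simp add: power2_eq_square)
    finally have "- (D * D') \<le> N / 2 * x t powr (d - 1) * U t * D\<^sup>2"
      using abs_ge_minus_self[of "D * D'"] by (simp add: abs_mult)
    then show "0 \<le> (2 * D * D' + N * x t powr (d - 1) * U t * D\<^sup>2) * exp (- (N / d * x t powr d))"
      by simp
  qed (use that in auto)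
  have "Q t \<le> 0"
  proof (rule tendsto_lowerbound[of Q 0 at_top])
    show "(Q \<longlongrightarrow> 0) at_top"
    proof (rule Lim_null_comparison)
      show "\<forall>\<^sub>F t in at_top. norm (Q t) \<le> (U t - V t)\<^sup>2"
        using N d by (intro always_eventually allI) (simp add: Q_def abs_mult mult_left_le)
      have "((\<lambda>t. (U t - V t)\<^sup>2) \<longlongrightarrow> (0 - 0)\<^sup>2) at_top"
        by (intro tendsto_intros U_lim V_lim)
      then show "((\<lambda>t. (U t - V t)\<^sup>2) \<longlongrightarrow> 0) at_top" by simp
    qed
    show "\<forall>\<^sub>F s in at_top. Q t \<le> Q s"
      using Q_mono[OF t] by (rule eventually_at_top_linorderI)
  qed simp
  then have "(U t - V t)\<^sup>2 \<le> 0" by (simp add: Q_def mult_le_0_iff not_le)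
  then have "U t = V t" by simp
  then have "q t = V t powr B" using UB[OF t] by simp
  then show ?thesis
    using xq[OF t] by (simp add: on_curve_def q_def V_def x_def B_def)
qed

text \<open>Along \<open>w\<close> the position passes through every value from \<open>r\<close>
  down towards 0, and on the curve the position determines the momentum. Hence \<open>u T\<close> is
  a state of \<open>w\<close>, and uniqueness does the rest.\<close>

lemma on_curve_translation:
  assumes v: "fast_curve r K v" and w: "is_path a b \<gamma> w" "fst (w 0) = r"
    "\<And>t. t \<ge> 0 \<Longrightarrow> on_curve r v (w t)"
    and u: "is_path a b \<gamma> u" "on_curve r v (u T)"
  shows "\<exists>\<Delta>. u = (\<lambda>t. w (t + \<Delta>))"
proof -
  have pos: "0 < fst (u T)" and le: "fst (u T) \<le> r" using u(2) by (auto simp: on_curve_def)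
  have "\<forall>\<^sub>F t in at_top. fst (w t) < fst (u T)"
    using order_tendstoD(2)[OF path_fst_tendsto_0[OF w(1)] pos] .
  then obtain R where R: "R \<ge> 0" "fst (w R) \<le> fst (u T)"
    by (metis eventually_at_top_linorder less_imp_le linorder_linear order_refl)
  obtain s where s: "0 \<le> s" "fst (w s) = fst (u T)"
    using IVT2'[of "\<lambda>t. fst (w t)" R "fst (u T)" 0] R le w(2) path_continuous_on[OF w(1)]
    by (auto intro: continuous_intros)
  then have eq: "w s = u T"
    using w(3)[OF s(1)] u(2) by (simp add: on_curve_def prod_eq_iff)
  have "u = (\<lambda>t. w (t + (s - T)))"
  proof (rule is_path_unique[OF u(1) path_shift[OF w(1)], of T])
    show "u T \<noteq> 0" using pos by auto
  qed (use eq in simp)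
  then show ?thesis by blast
qed

text \<open>Stated for a path of the time-reversed system, whose friction coefficient is negative.\<close>

lemma reversed_leaves_quadrant:
  assumes y: "is_path a b (- \<gamma>) y" and y0: "0 < fst (y 0)" and pos: "\<And>s. s \<ge> 0 \<Longrightarrow> 0 < snd (y s)"
  shows False
proof -
  define X where "X s = fst (y s)" for s
  define P where "P s = snd (y s)" for s
  have P_pos: "P s > 0" if "s \<ge> 0" for s using pos[OF that] by (simp add: P_def)
  have X': "(X has_real_derivative P s powr (a - 1)) (at s)" if "s \<ge> 0" for s
    using solves_fst[of a b "- \<gamma>" y UNIV s] y P_pos[OF that]
    by (simp add: is_path_iff_solves X_def[abs_def] P_def spow_pos)
  have X_mono: "X s \<le> X t" if "0 \<le> s" "s \<le> t" for s t
    by (rule nondecreasing_within[OF that(2) subset_UNIV X']) (use that in auto)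
  have X_pos: "X s > 0" if "s \<ge> 0" for s
    using X_mono[of 0 s] y0 that by (simp add: X_def)
  have P': "(P has_real_derivative \<gamma> * P s - X s powr (b - 1)) (at s)" if "s \<ge> 0" for s
    using solves_snd[of a b "- \<gamma>" y UNIV s] y X_pos[OF that]
    by (simp add: is_path_iff_solves X_def P_def[abs_def] spow_pos)
  \<comment> \<open>If the force ever exceeded the negative friction, it would continue to do so, as
    X does not decrease; the deficit of P would grow exponentially and make P negative.\<close>
  have ge: "X s powr (b - 1) \<le> \<gamma> * P s" if s: "s \<ge> 0" for s
  proof (rule ccontr)
    assume less: "\<not> ?thesis"
    define k where "k = X s powr (b - 1)"
    define e where "e = k / \<gamma> - P s"
    have k: "k > 0" using X_pos[OF s] by (simp add: k_def)
    have e: "e > 0" using less gamma by (simp add: e_def k_def field_simps)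
    \<comment> \<open>Here \<gamma> e t = k/\<gamma>, so the estimate exp(\<gamma> t) \<ge> 1 +
      \<gamma> t already brings P down to \<open>- e\<close>.\<close>
    define t where "t = k / (\<gamma>\<^sup>2 * e)"
    have t: "t > 0" using k e gamma by (simp add: t_def)
    have "(P (s + t) - k / \<gamma>) * exp (- \<gamma> * (s + t)) \<le> (P s - k / \<gamma>) * exp (- \<gamma> * s)"
    proof (rule nonincreasing_within[of s "s + t" UNIV])
      fix u assume "u \<in> {s..s + t}"
      then have u: "s \<le> u" "0 \<le> u" using s by auto
      show "((\<lambda>u. (P u - k / \<gamma>) * exp (- \<gamma> * u)) has_real_derivative
          (k - X u powr (b - 1)) * exp (- \<gamma> * u)) (at u)"
        by (rule derivative_eq_intros P'[OF u(2)] refl)+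
          (use gamma in \<open>simp add: field_simps\<close>)
      have "k \<le> X u powr (b - 1)"
        unfolding k_def using X_mono[OF s u(1)] X_pos[OF s] b by (intro powr_mono2) auto
      then show "(k - X u powr (b - 1)) * exp (- \<gamma> * u) \<le> 0" by (simp add: mult_le_0_iff)
    qed (use t in auto)
    then have "(P (s + t) - k / \<gamma>) * exp (- \<gamma> * (s + t)) * exp (\<gamma> * (s + t))
        \<le> - e * exp (- \<gamma> * s) * exp (\<gamma> * (s + t))"
      by (intro mult_right_mono) (auto simp: e_def)
    then have "P (s + t) - k / \<gamma> \<le> - e * exp (\<gamma> * t)"
      by (simp add: mult.assoc flip: exp_add) (simp add: algebra_simps)
    also have "\<dots> \<le> - e * (1 + \<gamma> * t)"
      using exp_ge_add_one_self[of "\<gamma> * t"] e by simp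
    also have "\<dots> = - e - k / \<gamma>"
      using e gamma by (simp add: t_def field_simps power2_eq_square)
    finally show False using P_pos[of "s + t"] s t e by simp
  qed
  have P_mono: "P 0 \<le> P s" if "s \<ge> 0" for s
    by (rule nondecreasing_within[OF that subset_UNIV P']) (use ge in auto)
  have X_linear: "P 0 powr (a - 1) * s \<le> X s" if s: "s \<ge> 0" for s
  proof -
    have "X 0 - P 0 powr (a - 1) * 0 \<le> X s - P 0 powr (a - 1) * s"
    proof (rule nondecreasing_within[OF s subset_UNIV])
      fix u assume "u \<in> {0..s}"
      then have u: "u \<ge> 0" by simp
      show "((\<lambda>s. X s - P 0 powr (a - 1) * s) has_real_derivative
          P u powr (a - 1) - P 0 powr (a - 1)) (at u)"
        using X'[OF u] by (auto intro!: derivative_eq_intros)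
      show "0 \<le> P u powr (a - 1) - P 0 powr (a - 1)"
        using P_mono[OF u] P_pos[of 0] a by (auto intro!: powr_mono2)
    qed
    then show ?thesis using X_pos[of 0] by simp
  qed
  have P_le: "P s powr (a - 1) \<le> P 0 powr (a - 1) + (a - 1) * \<gamma> * X s" if s: "s \<ge> 0" for s
  proof -
    have "P s powr (a - 1) - (a - 1) * \<gamma> * X s \<le> P 0 powr (a - 1) - (a - 1) * \<gamma> * X 0"
    proof (rule nonincreasing_within[OF s subset_UNIV])
      fix u assume "u \<in> {0..s}"
      then have u: "u \<ge> 0" by simp
      show "((\<lambda>s. P s powr (a - 1) - (a - 1) * \<gamma> * X s) has_real_derivative
          (a - 1) * P u powr (a - 2) * (\<gamma> * P u - X u powr (b - 1))
          - (a - 1) * \<gamma> * P u powr (a - 1)) (at u)"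
        by (rule derivative_eq_intros P'[OF u] X'[OF u] refl | use P_pos[OF u] in simp)+
      have "P u powr (a - 1) = P u * P u powr (a - 2)"
        using powr_mult_base[of "P u" "a - 2"] P_pos[OF u] by simp
      then have "(a - 1) * P u powr (a - 2) * (\<gamma> * P u - X u powr (b - 1))
          - (a - 1) * \<gamma> * P u powr (a - 1) = - ((a - 1) * P u powr (a - 2) * X u powr (b - 1))"
        by (simp add: algebra_simps)
      then show "(a - 1) * P u powr (a - 2) * (\<gamma> * P u - X u powr (b - 1))
          - (a - 1) * \<gamma> * P u powr (a - 1) \<le> 0"
        using a by simp
    qed
    moreover have "0 \<le> (a - 1) * \<gamma> * X 0" using X_pos[of 0] a gamma by simp
    ultimately show ?thesis by linarith
  qed
  define k where "k = b * a - b - a"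
  have k: "k > 0" using rate_pos by (simp add: k_def)
  define D where "D = \<gamma> powr (a - 1) * (P 0 powr (a - 1) + (a - 1) * \<gamma>)"
  have D: "D \<ge> 0" using a gamma by (simp add: D_def)
  \<comment> \<open>By \<open>ge\<close>, a multiple of P^(a-1) dominates X to the power
    \<open>k + 1\<close>, while by \<open>P_le\<close> it is at most linear in X. As
    \<open>k > 0\<close>, this bounds X, against its linear growth in time.\<close>
  have X_le: "X s powr k \<le> D" if s: "s \<ge> 0" and X1: "X s \<ge> 1" for s
  proof -
    have "X s * X s powr k = X s powr ((b - 1) * (a - 1))"
      using powr_mult_base[of "X s" k] X1 by (simp add: k_def algebra_simps)
    also have "\<dots> = (X s powr (b - 1)) powr (a - 1)" by (simp add: powr_powr)
    also have "\<dots> \<le> (\<gamma> * P s) powr (a - 1)" using ge[OF s] a by (intro powr_mono2) auto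
    also have "\<dots> = \<gamma> powr (a - 1) * P s powr (a - 1)"
      using gamma P_pos[OF s] by (simp add: powr_mult)
    also have "\<dots> \<le> \<gamma> powr (a - 1) * (P 0 powr (a - 1) * X s + (a - 1) * \<gamma> * X s)"
    proof (rule mult_left_mono)
      have "P 0 powr (a - 1) * 1 \<le> P 0 powr (a - 1) * X s" using X1 by (intro mult_left_mono) auto
      then show "P s powr (a - 1) \<le> P 0 powr (a - 1) * X s + (a - 1) * \<gamma> * X s"
        using P_le[OF s] by simp
    qed simp
    also have "\<dots> = X s * D" by (simp add: D_def algebra_simps)
    finally show ?thesis using X1 by simp
  qed
  define Y where "Y = max 1 ((D + 1) powr (1 / k))"
  define s where "s = Y / P 0 powr (a - 1)"
  have s: "s \<ge> 0" by (simp add: s_def Y_def)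
  have "P 0 powr (a - 1) > 0" using P_pos[of 0] by simp
  then have XY: "Y \<le> X s" using X_linear[OF s] by (simp add: s_def)
  have "((D + 1) powr (1 / k)) powr k \<le> X s powr k"
    using XY k by (intro powr_mono2) (auto simp: Y_def)
  moreover have "X s powr k \<le> D" using X_le[OF s] XY by (simp add: Y_def)
  ultimately show False using D k by (simp add: powr_powr)
qed

text \<open>Without a zero, p would be negative at all earlier times, and the reversed path would
  remain in the quadrant x > 0, p > 0 for ever.\<close>

lemma path_at_rest:
  assumes w: "is_path a b \<gamma> w" and "0 < fst (w 0)" "snd (w 0) < 0"
  shows "\<exists>\<tau>. snd (w \<tau>) = 0"
proof (rule ccontr)
  assume no: "\<not> ?thesis"
  define y where "y s = (fst (w (- s)), - snd (w (- s)))" for s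
  have "is_path a b (- \<gamma>) y"
    using solves_reverse[of a b \<gamma> w UNIV] w solves_subset[of a b \<gamma> w UNIV "range uminus"]
    by (simp add: is_path_iff_solves y_def[abs_def])
  moreover have "0 < snd (y s)" if s: "s \<ge> 0" for s
  proof (rule ccontr)
    assume "\<not> 0 < snd (y s)"
    then have "0 \<le> snd (w (- s))" by (simp add: y_def)
    then have "\<exists>u\<ge>- s. u \<le> 0 \<and> snd (w u) = 0"
      using assms(3) s path_continuous_on[OF w]
      by (intro IVT2'[of "\<lambda>t. snd (w t)" 0 0 "- s"]) (auto intro: continuous_intros)
    then show False using no by blast
  qed
  ultimately show False
    using reversed_leaves_quadrant[of y] assms(2) by (simp add: y_def)
qed

end

text \<open>The zero path is a separate exception, being a translation of neither fast path.
  Eventual non-vanishing of x is stated explicitly because \<open>inverse 0 = 0\<close>.\<close>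

theorem proposition2p7:
  fixes a b \<gamma> :: real
  assumes "a > 1" and "b > 1" and "\<gamma> > 0" and "1 / b + 1 / a < 1"
  shows "\<exists>\<eta>>0.
    (\<forall>t. \<bar>fst (rest_path a b \<gamma> (- \<eta>) t)\<bar> = \<bar>fst (rest_path a b \<gamma> \<eta> t)\<bar>) \<and>
    (\<forall>\<alpha><\<gamma> * (a - 1). (\<lambda>t. \<bar>fst (rest_path a b \<gamma> \<eta> t)\<bar>) \<in> O(\<lambda>t. exp (- \<alpha> * t))) \<and>
    (\<forall>z. is_path a b \<gamma> z \<and> z \<noteq> (\<lambda>t. (0, 0)) \<and>
         \<not> is_time_translation z (rest_path a b \<gamma> \<eta>) \<and>
         \<not> is_time_translation z (rest_path a b \<gamma> (- \<eta>)) \<longrightarrow>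
       (\<forall>\<^sub>F t in at_top. fst (z t) \<noteq> 0) \<and>
       (\<lambda>t. \<bar>inverse (fst (z t))\<bar>) \<in> O(\<lambda>t. t powr (1 / (b * a - b - a))) \<and>
       sublinearly_fast (\<lambda>t. fst (z t)) \<and> \<not> linearly_fast (\<lambda>t. fst (z t)))"
proof -
  have "(a - 1) * (b - 1) > 1" using assms by (simp add: field_simps)
  with assms interpret damped a b \<gamma> by unfold_locales
  obtain r K v where v: "fast_curve r K v" using fast_curve_exists by blast
  obtain w where w: "is_path a b \<gamma> w" "fst (w 0) = r" "\<And>t. t \<ge> 0 \<Longrightarrow> on_curve r v (w t)"
    using fast_path_exists[OF v] by blast
  have "r > 0" using v by (simp add: fast_curve_def)
  then have "snd (w 0) < 0"
    using w(2) w(3)[of 0] fast_curve_pos[OF v, of r] by (simp add: on_curve_def)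
  then obtain \<tau> where \<tau>: "snd (w \<tau>) = 0"
    using path_at_rest[OF w(1)] \<open>r > 0\<close> w(2) by auto
  have "fst (w 0) \<noteq> 0" using \<open>r > 0\<close> w(2) by simp
  then have "w 0 \<noteq> 0" by force
  then have "w \<tau> \<noteq> 0" by (rule is_path_nonzero[OF w(1)])
  then have "fst (w \<tau>) \<noteq> 0" using \<tau> by (auto simp: prod_eq_iff)
  define \<eta> where "\<eta> = \<bar>fst (w \<tau>)\<bar>"
  have \<eta>: "\<eta> > 0" using \<open>fst (w \<tau>) \<noteq> 0\<close> by (simp add: \<eta>_def)
  \<comment> \<open>The argument at rest fixes no sign of the rest position; \<sigma> normalises it,
    so that both rest paths are signed translations of \<open>w\<close>.\<close>
  define \<sigma> where "\<sigma> = sgn (fst (w \<tau>))"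
  have \<sigma>: "\<sigma> = 1 \<or> \<sigma> = - 1" using \<open>fst (w \<tau>) \<noteq> 0\<close> by (auto simp: \<sigma>_def sgn_if)
  have rest: "rest_path a b \<gamma> (s * \<eta>) = (\<lambda>t. (s * \<sigma>) *\<^sub>R w (t + \<tau>))" if "s = 1 \<or> s = - 1" for s
  proof (rule rest_path_eqI)
    have "s * \<sigma> = 1 \<or> s * \<sigma> = - 1" using that \<sigma> by auto
    then show "is_path a b \<gamma> (\<lambda>t. (s * \<sigma>) *\<^sub>R w (t + \<tau>))"
      using path_shift[OF w(1)] path_minus[OF path_shift[OF w(1)]] by auto
    show "(s * \<sigma>) *\<^sub>R w (0 + \<tau>) = (s * \<eta>, 0)"
      using \<tau> by (simp add: prod_eq_iff \<sigma>_def \<eta>_def abs_sgn)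
    show "s * \<eta> \<noteq> 0" using that \<eta> by auto
  qed
  have rest_eq: "rest_path a b \<gamma> \<eta> = (\<lambda>t. \<sigma> *\<^sub>R w (t + \<tau>))"
    "rest_path a b \<gamma> (- \<eta>) = (\<lambda>t. - (\<sigma> *\<^sub>R w (t + \<tau>)))"
    using rest[of 1] rest[of "- 1"] by simp_all
  show ?thesis
  proof (intro exI[of _ \<eta>] conjI allI impI \<eta>)
    fix t
    show "\<bar>fst (rest_path a b \<gamma> (- \<eta>) t)\<bar> = \<bar>fst (rest_path a b \<gamma> \<eta> t)\<bar>"
      by (simp add: rest_eq)
  next
    fix \<alpha> assume \<alpha>: "\<alpha> < \<gamma> * (a - 1)"
    have "(\<lambda>t. fst (w t)) \<in> O(\<lambda>t. exp (- \<alpha> * t))"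
      by (rule fast_path_rate[OF v w(1,3) \<alpha>])
    then have "(\<lambda>t. fst (w (t + \<tau>))) \<in> O(\<lambda>t. exp (- \<alpha> * (t + \<tau>)))"
      by (rule landau_o.big.compose) real_asymp
    also have "(\<lambda>t. exp (- \<alpha> * (t + \<tau>))) = (\<lambda>t. exp (- \<alpha> * \<tau>) * exp (- \<alpha> * t))"
      by (simp add: algebra_simps flip: exp_add)
    also have "\<dots> \<in> O(\<lambda>t. exp (- \<alpha> * t))" by simp
    finally have "(\<lambda>t. fst (w (t + \<tau>))) \<in> O(\<lambda>t. exp (- \<alpha> * t))" .
    moreover have "\<bar>fst (rest_path a b \<gamma> \<eta> t)\<bar> = \<bar>fst (w (t + \<tau>))\<bar>" for t
      using \<sigma> by (auto simp: rest_eq abs_mult)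
    ultimately show "(\<lambda>t. \<bar>fst (rest_path a b \<gamma> \<eta> t)\<bar>) \<in> O(\<lambda>t. exp (- \<alpha> * t))"
      by simp
  next
    fix z
    assume z: "is_path a b \<gamma> z \<and> z \<noteq> (\<lambda>t. (0, 0)) \<and>
         \<not> is_time_translation z (rest_path a b \<gamma> \<eta>) \<and>
         \<not> is_time_translation z (rest_path a b \<gamma> (- \<eta>))"
    then have path: "is_path a b \<gamma> z" by simp
    obtain s where s: "z s \<noteq> 0" using z by (auto simp: fun_eq_iff zero_prod_def)
    obtain R where "small_radius R" using small_radius_exists by blast
    \<comment> \<open>Below \<open>R\<close> the captured region is invariant, and below
      \<open>r\<close> the fast curve is defined.\<close>
    define \<rho> where "\<rho> = min R r"
    have \<rho>: "small_radius \<rho>"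
      using \<open>small_radius R\<close> \<open>r > 0\<close> by (auto simp: small_radius_def \<rho>_def)
    have "\<exists>t. captured \<rho> (z t) \<or> captured \<rho> (- z t)"
    proof (rule ccontr)
      assume "\<not> ?thesis"
      then obtain T u where u: "u = z \<or> u = (\<lambda>t. - z t)"
        "\<And>t. t \<ge> T \<Longrightarrow> 0 < fst (u t) \<and> fst (u t) \<le> \<rho> \<and> snd (u t) < 0 \<and>
          2 / \<gamma> * fst (u t) powr (b - 1) < - snd (u t)"
        using not_captured_cases[OF \<rho> path s] by metis
      have up: "is_path a b \<gamma> u" using u(1) path path_minus by auto
      have "on_curve r v (u T)"
        by (rule eventually_on_curve[OF v up, of T]) (use u(2) in \<open>auto simp: \<rho>_def\<close>)
      then obtain \<Delta> where \<Delta>: "u = (\<lambda>t. w (t + \<Delta>))"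
        using on_curve_translation[OF v w up] by blast
      have "z = (\<lambda>t. w (t + \<Delta>)) \<or> z = (\<lambda>t. - w (t + \<Delta>))"
        using u(1) \<Delta> by (auto simp: fun_eq_iff minus_equation_iff)
      \<comment> \<open>The rest paths are \<open>w\<close> shifted by \<tau> up to sign, so a shift
        of \<open>w\<close> by \<Delta> is one of them shifted by \<Delta> - \<tau>.\<close>
      moreover have "w (t + \<Delta>) = w ((t + (\<Delta> - \<tau>)) + \<tau>)" for t by simp
      ultimately have "is_time_translation z (rest_path a b \<gamma> \<eta>) \<or>
          is_time_translation z (rest_path a b \<gamma> (- \<eta>))"
        using \<sigma> unfolding is_time_translation_def rest_eq
        by (metis (no_types, lifting) minus_minus scaleR_minus_left scaleR_one)
      then show False using z by blast
    qed
    then obtain t0 where "captured \<rho> (z t0) \<or> captured \<rho> (- z t0)" by blast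
    then have "\<exists>C. \<forall>\<^sub>F t in at_top. fst (z t) \<noteq> 0 \<and>
        \<bar>inverse (fst (z t))\<bar> \<le> C * t powr (1 / (b * a - b - a))"
    proof
      assume "captured \<rho> (z t0)"
      then show ?thesis
        using captured_slow[OF path, of t0 \<rho>] captured_forward[OF \<rho> path] by blast
    next
      assume "captured \<rho> (- z t0)"
      then have "\<exists>C. \<forall>\<^sub>F t in at_top. fst (- z t) \<noteq> 0 \<and>
          \<bar>inverse (fst (- z t))\<bar> \<le> C * t powr (1 / (b * a - b - a))"
        using captured_slow[OF path_minus[OF path], of t0 \<rho>]
          captured_forward[OF \<rho> path_minus[OF path], of t0] by blast
      then show ?thesis by simp
    qed
    then obtain C where C: "\<forall>\<^sub>F t in at_top. fst (z t) \<noteq> 0 \<and>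
        \<bar>inverse (fst (z t))\<bar> \<le> C * t powr (1 / (b * a - b - a))" ..
    have k: "1 / (b * a - b - a) > 0" using rate_pos by simp
    show "\<forall>\<^sub>F t in at_top. fst (z t) \<noteq> 0"
      "(\<lambda>t. \<bar>inverse (fst (z t))\<bar>) \<in> O(\<lambda>t. t powr (1 / (b * a - b - a)))"
      "sublinearly_fast (\<lambda>t. fst (z t))" "\<not> linearly_fast (\<lambda>t. fst (z t))"
      by (rule slow_decay[OF k C])+
  qed
qed

end
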